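(* Let $\rho>0$ and let $\mathscr{D}[\rho]\subset\mathbb{R}^{n}$ be the ellitope at uncertainty level $\rho$ defined in the context by the data $P\in\mathbb{R}^{n\times\bar n}$, $S_1,\dots,S_K\in\mathbb{S}^{\bar n}_+$, $\mathcal{T}\subset\mathbb{R}^K_+$. Let $\phi_{\mathcal{T}}(\lambda)=\max_{t\in\mathcal{T}}\lambda^{\mathrm T}t$ be the support function of $\mathcal{T}$. For $s>0$ consider the semi-infinite constraint in variables $X\in\mathbb{S}^{n}$, $x\in\mathbb{R}^{n}$, $\xi\in\mathbb{R}$: $$(C[s]):\qquad \zeta^{\mathrm T}X\zeta+2x^{\mathrm T}\zeta\le\xi\quad\text{for all }\zeta\in\mathscr{D}[s],$$ and the system of convex constraints in variables $X,x,\xi$, $\lambda\in\mathbb{R}^K$, $\tau\in\mathbb{R}$: $$(S[\rho]):\qquad \lambda_k\ge0,\ k\le K,\qquad \begin{bmatrix}\sum_{k}\lambda_kS_k-P^{\mathrm T}XP&-P^{\mathrm T}x\\-x^{\mathrm T}P&\tau\end{bmatrix}\succeq0,\qquad \rho\,\phi_{\mathcal{T}}(\lambda)+\tau\le\xi .$$ Then: (i) $(S[\rho])$ is a safe approximation of $(C[\rho])$: whenever $(X,x,\xi)$ can be augmented by some $\lambda,\tau$ to a feasible solution of $(S[\rho])$, $(X,x,\xi)$ is feasible for $(C[\rho])$. (ii) This approximation is tight within the factor $\varkappa=3\ln(6K)$: whenever $(X,x,\xi)$ cannot be augmented by $\lambda,\tau$ to a feasible solution of $(S[\rho])$, $(X,x,\xi)$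 is not feasible for $(C[\varkappa\rho])$.
   Context: $\mathbb{S}^m$ is the space of real symmetric $m\times m$ matrices, $\mathbb{S}^m_+$ the cone of positive semidefinite ones; $A\succeq B$ means $A-B\in\mathbb{S}^m_+$, and $A\succ B$ means that $A-B$ is positive definite. Ellitopes: let $K\ge1$, let $P$ be a real $n\times\bar n$ matrix, let $S_k\in\mathbb{S}^{\bar n}$ with $S_k\succeq0$ for $k=1,\dots,K$ and $\sum_kS_k\succ0$. Let $\mathcal{T}\subset\mathbb{R}^K_+$ be a nonempty convex compact set which intersects the interior of $\mathbb{R}^K_+$ and is monotone: if $0\le t\le t'$ (entrywise) and $t'\in\mathcal{T}$, then $t\in\mathcal{T}$. For $\rho>0$, $$\mathscr{D}[\rho]=\{\zeta\in\mathbb{R}^n:\ \exists z\in\mathbb{R}^{\bar n},\,t\in\mathcal{T}:\ \zeta=Pz,\ z^{\mathrm T}S_kz\le\rho\,t_k,\ k=1,\dots,K\}.$$ *)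

theory Defs
  imports "HOL-Analysis.Analysis"
begin

definition sym_mat :: "real^'a^'a \<Rightarrow> bool" where
  "sym_mat A \<longleftrightarrow> transpose A = A"

definition psd :: "real^'a^'a \<Rightarrow> bool" where
  "psd A \<longleftrightarrow> sym_mat A \<and> (\<forall>v. 0 \<le> v \<bullet> (A *v v))"

definition posdef :: "real^'a^'a \<Rightarrow> bool" where
  "posdef A \<longleftrightarrow> sym_mat A \<and> (\<forall>v. v \<noteq> 0 \<longrightarrow> 0 < v \<bullet> (A *v v))"

text \<open>The index type \<open>'m option\<close> has one element more than \<open>'m\<close>; \<open>None\<close> is the index of the
  additional row and column, so this is the block matrix with rows \<open>(A, b)\<close> and \<open>(c\<^sup>T, d)\<close>.\<close>

definition bordered :: "real^'m^'m \<Rightarrow> real^'m \<Rightarrow> real^'m \<Rightarrow> real \<Rightarrow> real^('m option)^('m option)" where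
  "bordered A b c d = (\<chi> i j.
     case i of
       Some i' \<Rightarrow> (case j of Some j' \<Rightarrow> A $ i' $ j' | None \<Rightarrow> b $ i')
     | None \<Rightarrow> (case j of Some j' \<Rightarrow> c $ j' | None \<Rightarrow> d))"

definition support_fun :: "(real^'k) set \<Rightarrow> real^'k \<Rightarrow> real" where
  "support_fun T l = (SUP t\<in>T. l \<bullet> t)"

text \<open>On a nonempty compact set the supremum is a maximum.\<close>

lemma support_fun_max:
  fixes T :: "(real^'k) set"
  assumes "compact T" and "T \<noteq> {}"
  shows "\<exists>t\<in>T. support_fun T l = l \<bullet> t \<and> (\<forall>t'\<in>T. l \<bullet> t' \<le> l \<bullet> t)"
proof -
  have "continuous_on T (\<lambda>t. l \<bullet> t)"
    by (intro continuous_intros)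
  then obtain t where t: "t \<in> T" "\<And>t'. t' \<in> T \<Longrightarrow> l \<bullet> t' \<le> l \<bullet> t"
    using continuous_attains_sup[OF assms] by blast
  have "support_fun T l = l \<bullet> t"
    unfolding support_fun_def by (rule cSup_eq_maximum) (use t in auto)
  with t show ?thesis by blast
qed

definition ellitope ::
  "real^'m^'n \<Rightarrow> ('k \<Rightarrow> real^'m^'m) \<Rightarrow> (real^'k) set \<Rightarrow> real \<Rightarrow> (real^'n) set" where
  "ellitope P S T \<rho> =
     {\<zeta>. \<exists>z. \<exists>t\<in>T. \<zeta> = P *v z \<and> (\<forall>k. z \<bullet> (S k *v z) \<le> \<rho> * t $ k)}"

definition C_feasible ::
  "real^'m^'n \<Rightarrow> ('k \<Rightarrow> real^'m^'m) \<Rightarrow> (real^'k) set \<Rightarrow> real \<Rightarrow>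
   real^'n^'n \<Rightarrow> real^'n \<Rightarrow> real \<Rightarrow> bool" where
  "C_feasible P S T s X x \<xi> \<longleftrightarrow>
     (\<forall>\<zeta>\<in>ellitope P S T s. \<zeta> \<bullet> (X *v \<zeta>) + 2 * (x \<bullet> \<zeta>) \<le> \<xi>)"

definition S_feasible ::
  "real^'m^'n \<Rightarrow> ('k \<Rightarrow> real^'m^'m) \<Rightarrow> (real^'k) set \<Rightarrow> real \<Rightarrow>
   real^'n^'n \<Rightarrow> real^'n \<Rightarrow> real \<Rightarrow> real^'k \<Rightarrow> real \<Rightarrow> bool" where
  "S_feasible P S T \<rho> X x \<xi> l \<tau> \<longleftrightarrow>
     (\<forall>k. 0 \<le> l $ k) \<and>
     psd (bordered ((\<Sum>k\<in>UNIV. l $ k *\<^sub>R S k) - transpose P ** X ** P)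
                   (- (transpose P *v x)) (- (x v* P)) \<tau>) \<and>
     \<rho> * support_fun T l + \<tau> \<le> \<xi>"

end

theory Submission
  imports Defs
begin

text \<open>
  Safety is weak duality: at \<open>(z, 1)\<close> the semidefinite constraint bounds the quadratic function on the
  ellitope by the objective of the approximation.

  Tightness combines strong duality with a randomized rounding. Adjoin a coordinate \<open>y\<^sub>0\<close> to \<open>z\<close> and let
  \<open>W\<close> be the matrix of the form \<open>z\<^sup>T P\<^sup>T X P z + 2 y\<^sub>0 x\<^sup>T P z\<close>. By separation of convex sets
  (\<open>semidefinite_alternative\<close>), if the approximation is infeasible, there are a semidefinite matrix \<open>V\<close> and
  \<open>t \<in> T\<close> such that \<open>W \<bullet> V > \<xi>\<close>, the \<open>y\<^sub>0\<close>-entry of \<open>V\<close> is less than \<open>1\<close>, and \<open>S\<^sub>k \<bullet> V < \<rho> t\<^sub>k\<close> for all \<open>k\<close>. Such a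
  \<open>V\<close> is the second-moment matrix of a random vector, and a single vector with almost the same properties
  is to be extracted from it.

  Two applications of the spectral theorem (\<open>sym_mat_spectral\<close>) write \<open>V\<close> as a sum of \<open>v\<^sub>i v\<^sub>i\<^sup>T\<close> with
  \<open>v\<^sub>i\<^sup>T W v\<^sub>j = 0\<close> for \<open>i \<noteq> j\<close>. With independent random signs, \<open>y = \<Sum> \<plusminus>v\<^sub>i\<close> satisfies \<open>y\<^sup>T W y = W \<bullet> V\<close> for every
  outcome. The coordinate \<open>y\<^sub>0\<close> is a Rademacher sum of variance less than \<open>1\<close>, and \<open>\<bar>y\<^sub>0\<bar> \<le> 1\<close> has probability
  at least \<open>1/3\<close> (\<open>sign_mean_small_ball\<close>). Each form \<open>y\<^sup>T S\<^sub>k y\<close> has expectation \<open>S\<^sub>k \<bullet> V < \<rho> t\<^sub>k\<close> and an exponential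
  moment bounded as in the Gaussian case, so it exceeds \<open>g \<rho> t\<^sub>k\<close> with probability at most
  \<open>sqrt 3 * exp (- g / 3)\<close> (\<open>sign_mean_sum_squares_tail\<close>). For \<open>g = 3 ln (6 K)\<close> these \<open>K\<close> probabilities sum up to at
  most \<open>sqrt 3 / 6 < 1/3\<close>, so some outcome is good in every respect (\<open>sign_rounding\<close>); it or its negative
  violates the robust constraint at the level \<open>3 ln (6 K) \<rho>\<close>.
\<close>

text \<open>
  The first-order condition at a maximum: a linear term that a quadratic term dominates near the
  origin vanishes.
\<close>

section \<open>Orthogonal diagonalization of symmetric matrices\<close>

lemma quadratic_dominated_imp_zero:
  fixes b c :: real
  assumes "\<And>t. 2 * t * b \<le> t\<^sup>2 * c"
  shows "b = 0"
proof (rule ccontr)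
  assume "b \<noteq> 0"
  define K where "K = \<bar>c\<bar> + 1"
  have K: "K > 0" "c < K" unfolding K_def by auto
  \<comment> \<open>With \<open>K > c\<close>, the choice \<open>t = b / K\<close> makes the linear term win.\<close>
  from assms[of "b / K"] have "2 * (b\<^sup>2 / K) \<le> (b\<^sup>2 / K) * (c / K)"
    by (simp add: power2_eq_square field_simps)
  moreover have "b\<^sup>2 / K > 0" using K \<open>b \<noteq> 0\<close> by simp
  ultimately have "2 \<le> c / K" by (metis mult.commute mult_le_cancel_left_pos)
  with K show False by (simp add: field_simps)
qed

text \<open>
  A maximizer \<open>v\<close> of the quadratic form \<open>v \<bullet> f v\<close> on the unit sphere of \<open>U\<close> is an eigenvector. The form is at
  most \<open>M * (u \<bullet> u)\<close> on all of \<open>U\<close>, with equality at \<open>v\<close>; moving from \<open>v\<close> in an orthogonal direction \<open>w\<close> gives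
  \<open>w \<bullet> f v = 0\<close>, so \<open>f v\<close> has no component orthogonal to \<open>v\<close>.
\<close>

lemma self_adjoint_eigenvector:
  fixes f :: "'a::euclidean_space \<Rightarrow> 'a"
  assumes lin: "linear f" and sa: "\<And>x y. x \<bullet> f y = f x \<bullet> y"
    and U: "subspace U" "f ` U \<subseteq> U" "U \<noteq> {0}"
  obtains v d where "v \<in> U" "norm v = 1" "f v = d *\<^sub>R v"
proof -
  let ?S = "sphere 0 1 \<inter> U"
  obtain w where w: "w \<in> U" "w \<noteq> 0" using U subspace_0 by blast
  have "(1 / norm w) *\<^sub>R w \<in> ?S" using w U by (simp add: subspace_scale)
  moreover have "compact ?S" using U by (simp add: closed_subspace compact_Int_closed)
  moreover have "continuous_on ?S (\<lambda>v. v \<bullet> f v)"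
    using lin by (intro continuous_intros linear_continuous_on) (simp add: linear_linear)
  ultimately obtain v where v: "v \<in> ?S" "\<And>u. u \<in> ?S \<Longrightarrow> u \<bullet> f u \<le> v \<bullet> f v"
    using continuous_attains_sup[of ?S "\<lambda>v. v \<bullet> f v"] by blast
  define M where "M = v \<bullet> f v"
  have vv: "v \<bullet> v = 1" "v \<in> U" using v by (auto simp: norm_eq_1)
  have bound: "u \<bullet> f u \<le> M * (u \<bullet> u)" if "u \<in> U" for u
  proof (cases "u = 0")
    case True then show ?thesis using lin by (simp add: linear_0)
  next
    case False
    have "(1 / norm u) *\<^sub>R u \<in> ?S" using that False U by (simp add: subspace_scale)
    from v(2)[OF this] have "(u \<bullet> f u) / (norm u)\<^sup>2 \<le> M"
      by (simp add: M_def linear_scale[OF lin] power2_eq_square)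
    then show ?thesis using False by (simp add: field_simps power2_norm_eq_inner)
  qed
  have orth: "w \<bullet> f v = 0" if w: "w \<in> U" "w \<bullet> v = 0" for w
  proof (rule quadratic_dominated_imp_zero[where c = "M * (w \<bullet> w) - w \<bullet> f w"])
    fix t :: real
    have "v + t *\<^sub>R w \<in> U" using w vv U by (simp add: subspace_add subspace_scale)
    from bound[OF this]
    have "M + t * (v \<bullet> f w) + t * (w \<bullet> f v) + t * t * (w \<bullet> f w) \<le> M * (1 + t * t * (w \<bullet> w))"
      using vv w
      by (simp add: linear_add[OF lin] linear_scale[OF lin] inner_simps M_def inner_commute algebra_simps)
    moreover have "v \<bullet> f w = w \<bullet> f v" using sa inner_commute by metis
    ultimately show "2 * t * (w \<bullet> f v) \<le> t\<^sup>2 * (M * (w \<bullet> w) - w \<bullet> f w)"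
      by (simp add: algebra_simps power2_eq_square)
  qed
  let ?w = "f v - M *\<^sub>R v"
  have "?w \<in> U" using U vv by (auto intro!: subspace_diff subspace_scale)
  moreover have wv: "?w \<bullet> v = 0" using vv by (simp add: inner_simps M_def inner_commute)
  ultimately have "?w \<bullet> f v = 0" by (rule orth)
  then have "?w \<bullet> ?w = 0" using wv by (simp add: inner_diff_right)
  then have "f v = M *\<^sub>R v" by simp
  then show ?thesis using that v by auto
qed

text \<open>
  Induction on the dimension: the orthogonal complement of an eigenvector within an invariant
  subspace is again invariant, because \<open>f\<close> is self-adjoint.
\<close>

lemma self_adjoint_orthonormal_eigenbasis:
  fixes f :: "'a::euclidean_space \<Rightarrow> 'a"
  assumes lin: "linear f" and sa: "\<And>x y. x \<bullet> f y = f x \<bullet> y"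
    and "subspace U" "f ` U \<subseteq> U"
  shows "\<exists>B. B \<subseteq> U \<and> pairwise orthogonal B \<and> card B = dim U
    \<and> (\<forall>b\<in>B. norm b = 1 \<and> (\<exists>d. f b = d *\<^sub>R b))"
  using assms(3,4)
proof (induction "dim U" arbitrary: U)
  case 0
  then show ?case by (intro exI[of _ "{}"]) auto
next
  case (Suc n)
  then have "U \<noteq> {0}" by auto
  then obtain v d where v: "v \<in> U" "norm v = 1" "f v = d *\<^sub>R v"
    using self_adjoint_eigenvector[OF lin sa Suc.prems] by blast
  let ?U = "{u \<in> U. orthogonal v u}"
  have sub: "subspace ?U" using Suc.prems(1)
    by (auto simp: subspace_def orthogonal_def inner_simps)
  have inv: "f ` ?U \<subseteq> ?U"
  proof
    fix y assume "y \<in> f ` ?U"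
    then obtain u where u: "u \<in> U" "v \<bullet> u = 0" "y = f u" by (auto simp: orthogonal_def)
    have "v \<bullet> f u = 0" using sa[of v u] v u by simp
    then show "y \<in> ?U" using u Suc.prems by (auto simp: orthogonal_def)
  qed
  have "dim {u \<in> U. \<forall>x\<in>span {v}. orthogonal x u} + dim (span {v}) = dim U"
    by (rule dim_subspace_orthogonal_to_vectors) (use v Suc.prems subspace_span[of "{v}"] in \<open>auto simp: span_singleton subspace_scale\<close>)
  moreover have "{u \<in> U. \<forall>x\<in>span {v}. orthogonal x u} = ?U"
    by (auto simp: span_singleton orthogonal_def intro: exI[of _ 1])
  moreover have "v \<noteq> 0" using v by auto
  ultimately have "dim ?U = n" using Suc.hyps(2) by (simp add: dim_span)
  with Suc.hyps(1)[of ?U] sub inv obtain B where B: "B \<subseteq> ?U" "pairwise orthogonal B" "card B = n"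
     "\<forall>b\<in>B. norm b = 1 \<and> (\<exists>d. f b = d *\<^sub>R b)" by auto
  have "finite B" using B(2) pairwise_orthogonal_imp_finite by blast
  moreover have "v \<notin> B" using B(1) v by (auto simp: orthogonal_def)
  moreover have "pairwise orthogonal (insert v B)"
    using B(1,2) by (auto simp: pairwise_insert orthogonal_commute)
  ultimately show ?case using B v Suc.hyps(2) by (intro exI[of _ "insert v B"]) auto
qed

text \<open>
  Orthonormal rows of a square matrix force orthonormal columns.
\<close>

lemma orthonormal_family_complete:
  fixes u :: "'n \<Rightarrow> real^'n"
  assumes "\<And>i j. u i \<bullet> u j = (if i = j then 1 else 0)"
  shows "(\<Sum>l\<in>UNIV. u l $ i * u l $ j) = (if i = j then 1 else 0)"
proof -
  define U :: "real^'n^'n" where "U = (\<chi> l i. u l $ i)"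
  have "U ** transpose U = mat 1"
    using assms by (simp add: U_def matrix_matrix_mult_def transpose_def mat_def inner_vec_def vec_eq_iff)
  then have "transpose U ** U = mat 1" using matrix_left_right_inverse by blast
  then have "(transpose U ** U) $ i $ j = (mat 1 :: real^'n^'n) $ i $ j" by simp
  then show ?thesis by (simp add: U_def matrix_matrix_mult_def transpose_def mat_def)
qed

lemma dot_sym_mat:
  assumes "sym_mat A"
  shows "v \<bullet> (A *v w) = (A *v v) \<bullet> w"
  using assms unfolding sym_mat_def by (metis dot_lmul_matrix transpose_matrix_vector)

theorem sym_mat_spectral:
  fixes A :: "real^'n^'n"
  assumes "sym_mat A"
  obtains u :: "'n \<Rightarrow> real^'n" and d :: "'n \<Rightarrow> real"
    where "\<And>i j. u i \<bullet> u j = (if i = j then 1 else 0)" "\<And>i. A *v u i = d i *\<^sub>R u i"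
proof -
  obtain B :: "(real^'n) set" where B: "pairwise orthogonal B" "card B = CARD('n)"
      "\<forall>b\<in>B. norm b = 1 \<and> (\<exists>d. A *v b = d *\<^sub>R b)"
    using self_adjoint_orthonormal_eigenbasis[of "(*v) A" UNIV] dot_sym_mat[OF assms] by auto
  have "finite B" using B(1) pairwise_orthogonal_imp_finite by blast
  then obtain u :: "'n \<Rightarrow> real^'n" where u: "bij_betw u UNIV B"
    using finite_same_card_bij[of "UNIV :: 'n set" B] B by auto
  then have uB: "u i \<in> B" for i by (auto simp: bij_betw_def)
  have "\<forall>i. \<exists>d. A *v u i = d *\<^sub>R u i" using B(3) uB by blast
  then obtain d where "\<forall>i. A *v u i = d i *\<^sub>R u i" by (rule choice[THEN exE]) (rule that)
  moreover have "u i \<bullet> u j = (if i = j then 1 else 0)" for i j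
  proof (cases "i = j")
    case True
    then show ?thesis using uB B(3) by (simp add: norm_eq_1)
  next
    case False
    then have "u i \<noteq> u j" using bij_betw_imp_inj_on[OF u] by (auto simp: inj_on_def)
    then show ?thesis using uB B(1) False by (simp add: pairwise_def orthogonal_def)
  qed
  ultimately show ?thesis using that by blast
qed

text \<open>
  The entrywise form of \<open>A = U D U\<^sup>T\<close>.
\<close>

lemma spectral_expansion:
  fixes A :: "real^'n^'n" and u :: "'n \<Rightarrow> real^'n"
  assumes u: "\<And>i j. u i \<bullet> u j = (if i = j then 1 else 0)" and d: "\<And>i. A *v u i = d i *\<^sub>R u i"
  shows "A $ i $ j = (\<Sum>l\<in>UNIV. d l * (u l $ i * u l $ j))"
proof -
  have "A $ i $ j = (\<Sum>k\<in>UNIV. A $ i $ k * (if k = j then 1 else 0))"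
    by (simp add: if_distrib cong: if_cong)
  also have "\<dots> = (\<Sum>k\<in>UNIV. A $ i $ k * (\<Sum>l\<in>UNIV. u l $ k * u l $ j))"
    by (simp only: orthonormal_family_complete[OF u])
  also have "\<dots> = (\<Sum>k\<in>UNIV. \<Sum>l\<in>UNIV. A $ i $ k * u l $ k * u l $ j)"
    by (simp add: sum_distrib_left mult.assoc)
  also have "\<dots> = (\<Sum>l\<in>UNIV. \<Sum>k\<in>UNIV. A $ i $ k * u l $ k * u l $ j)"
    by (rule sum.swap)
  also have "\<dots> = (\<Sum>l\<in>UNIV. (A *v u l) $ i * u l $ j)"
    by (simp add: sum_distrib_right matrix_vector_mult_def)
  finally show ?thesis using d by (simp add: mult.assoc)
qed

text \<open>
  A set \<open>A \<subseteq> I\<close> stands for the sign vector that is \<open>1\<close> on \<open>A\<close> and \<open>- 1\<close> on \<open>I - A\<close>. Thus \<open>sign_mean I\<close> is the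
  expectation for independent uniformly distributed signs, and \<open>signed_sum I a\<close> is the Rademacher sum with
  coefficients \<open>a\<close>.
\<close>

section \<open>Averages over random signs\<close>

definition sign_mean :: "'i set \<Rightarrow> ('i set \<Rightarrow> real) \<Rightarrow> real" where
  "sign_mean I f = (\<Sum>A\<in>Pow I. f A) / 2 ^ card I"

definition signed_sum :: "'i set \<Rightarrow> ('i \<Rightarrow> real) \<Rightarrow> 'i set \<Rightarrow> real" where
  "signed_sum I a A = (\<Sum>i\<in>I. (if i \<in> A then 1 else - 1) * a i)"

lemma sign_mean_empty [simp]: "sign_mean {} f = f {}"
  by (simp add: sign_mean_def)

lemma signed_sum_empty [simp]: "signed_sum {} a A = 0"
  by (simp add: signed_sum_def)

lemma sign_mean_mono: "(\<And>A. A \<subseteq> I \<Longrightarrow> f A \<le> g A) \<Longrightarrow> sign_mean I f \<le> sign_mean I g"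
  unfolding sign_mean_def by (intro divide_right_mono sum_mono) auto

lemma sign_mean_const: "finite I \<Longrightarrow> sign_mean I (\<lambda>A. c) = c"
  by (simp add: sign_mean_def card_Pow)

lemma sign_mean_add: "sign_mean I (\<lambda>A. f A + g A) = sign_mean I f + sign_mean I g"
  by (simp add: sign_mean_def sum.distrib add_divide_distrib)

lemma sign_mean_cmult: "sign_mean I (\<lambda>A. c * f A) = c * sign_mean I f"
  by (simp add: sign_mean_def sum_distrib_left)

lemma sign_mean_sum: "sign_mean I (\<lambda>A. \<Sum>k\<in>L. f k A) = (\<Sum>k\<in>L. sign_mean I (f k))"
  unfolding sign_mean_def by (subst sum.swap) (simp add: sum_divide_distrib)

text \<open>
  The probabilistic method: this turns comparisons of expectations into the existence of signs.
\<close>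

lemma sign_mean_less_obtains:
  assumes "sign_mean I f < sign_mean I g"
  obtains A where "f A < g A"
proof -
  have "\<not> (\<forall>A. g A \<le> f A)"
    using assms sign_mean_mono[of I g f] by auto
  then show ?thesis using that by (auto simp: not_le)
qed

text \<open>
  Conditioning on the sign of one summand. The inductions on \<open>I\<close> below rest on this
  identity.
\<close>

lemma sign_mean_insert:
  assumes "finite I" "i \<notin> I"
  shows "sign_mean (insert i I) (\<lambda>A. f (signed_sum (insert i I) a A))
    = (sign_mean I (\<lambda>A. f (a i + signed_sum I a A)) + sign_mean I (\<lambda>A. f (- a i + signed_sum I a A))) / 2"
proof -
  let ?F = "\<lambda>A. f (signed_sum (insert i I) a A)"
  have inj: "inj_on (insert i) (Pow I)" using assms(2) by (auto simp: inj_on_def)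
  have plus: "signed_sum (insert i I) a (insert i A) = a i + signed_sum I a A" for A
    using assms unfolding signed_sum_def by (auto intro!: sum.cong)
  have minus: "signed_sum (insert i I) a A = - a i + signed_sum I a A" if "A \<subseteq> I" for A
    using assms that unfolding signed_sum_def by auto
  have "(\<Sum>A\<in>Pow (insert i I). ?F A) = (\<Sum>A\<in>Pow I. ?F A) + (\<Sum>A\<in>insert i ` Pow I. ?F A)"
    unfolding Pow_insert using assms by (intro sum.union_disjoint) auto
  also have "(\<Sum>A\<in>insert i ` Pow I. ?F A) = (\<Sum>A\<in>Pow I. f (a i + signed_sum I a A))"
    using inj by (simp add: sum.reindex plus)
  also have "(\<Sum>A\<in>Pow I. ?F A) = (\<Sum>A\<in>Pow I. f (- a i + signed_sum I a A))"
    by (intro sum.cong) (auto simp: minus)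
  finally show ?thesis
    using assms by (simp add: sign_mean_def field_simps)
qed

lemma sign_mean_reflect:
  assumes "finite I"
  shows "sign_mean I (\<lambda>A. f (signed_sum I a A)) = sign_mean I (\<lambda>A. f (- signed_sum I a A))"
  using assms
proof (induction I arbitrary: f)
  case (insert i I)
  show ?case
    using insert.IH[of "\<lambda>r. f (a i + r)"] insert.IH[of "\<lambda>r. f (- a i + r)"]
    by (simp add: sign_mean_insert[OF insert.hyps] sign_mean_insert[OF insert.hyps, where f = "\<lambda>r. f (- r)"])
qed simp

lemma sign_mean_square:
  assumes "finite I"
  shows "sign_mean I (\<lambda>A. (s + signed_sum I a A)\<^sup>2) = s\<^sup>2 + (\<Sum>i\<in>I. (a i)\<^sup>2)"
  using assms
proof (induction I arbitrary: s)
  case (insert i I)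
  show ?case
    using insert.IH[of "s + a i"] insert.IH[of "s - a i"] insert.hyps
    by (simp add: sign_mean_insert[OF insert.hyps, where f = "\<lambda>r. (s + r)\<^sup>2"] add.assoc[symmetric])
      (simp add: power2_eq_square algebra_simps)
qed simp

text \<open>
  Compare the power series term by term: \<open>(2 n)! \<ge> 2\<^sup>n n!\<close>.
\<close>

section \<open>Exponential moments of squared Rademacher sums\<close>

lemma cosh_le_exp_half_square: "cosh x \<le> exp (x\<^sup>2 / 2)" for x :: real
proof -
  have "(\<lambda>n. if even n then x ^ n /\<^sub>R fact n else 0) sums cosh x" by (rule cosh_converges)
  then have "(\<lambda>n. x ^ (2*n) /\<^sub>R fact (2*n)) sums cosh x"
    by (subst (asm) sums_mono_reindex[of "\<lambda>n. 2 * n", symmetric]) (auto simp: strict_mono_def)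
  moreover have "(\<lambda>n. (x\<^sup>2 / 2) ^ n /\<^sub>R fact n) sums exp (x\<^sup>2 / 2)" by (rule exp_converges)
  moreover have "x ^ (2*n) /\<^sub>R fact (2*n) \<le> (x\<^sup>2 / 2) ^ n /\<^sub>R fact n" for n
  proof -
    have "(2::real) ^ n * fact n \<le> fact (2*n)"
    proof (induction n)
      case (Suc n)
      have "(2::real) ^ Suc n * fact (Suc n) = (2 * real (Suc n)) * (2 ^ n * fact n)" by simp
      also have "\<dots> \<le> (2 * real (Suc n)) * fact (2 * n)" using Suc by (intro mult_left_mono) auto
      also have "\<dots> \<le> (2 * real (Suc n)) * ((2 * real n + 1) * fact (2 * n))"
        by (intro mult_left_mono) auto
      also have "\<dots> = fact (2 * Suc n)" by (simp add: algebra_simps)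
      finally show ?case .
    qed simp
    then have "(x\<^sup>2) ^ n / fact (2*n) \<le> (x\<^sup>2) ^ n / (2 ^ n * fact n)"
      by (intro divide_left_mono) auto
    then show ?thesis by (simp add: power_divide field_simps flip: power_mult)
  qed
  ultimately show ?thesis by (rule sums_le[rotated 1])
qed

text \<open>
  The right-hand side is the expectation of \<open>exp (c * (s + q * N)\<^sup>2)\<close> for a standard normal \<open>N\<close>: exchanging a
  random sign for a normal variable of the same variance only increases the expectation. In this form
  the comparison is elementary, from \<open>cosh x \<le> exp (x\<^sup>2 / 2)\<close> and \<open>1 - u \<le> exp (- u)\<close>.
\<close>

lemma gaussian_step:
  fixes c q s :: real
  assumes "0 \<le> c" "2 * c * q\<^sup>2 < 1"
  shows "(exp (c * (s + q)\<^sup>2) + exp (c * (s - q)\<^sup>2)) / 2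
    \<le> exp (c * s\<^sup>2 / (1 - 2 * c * q\<^sup>2)) / sqrt (1 - 2 * c * q\<^sup>2)"
proof -
  define u where "u = 2 * c * q\<^sup>2"
  have u: "0 \<le> u" "u < 1" using assms by (auto simp: u_def)
  have "(exp (c * (s + q)\<^sup>2) + exp (c * (s - q)\<^sup>2)) / 2 = exp (c * s\<^sup>2) * exp (u / 2) * cosh (2 * c * s * q)"
    by (simp add: cosh_field_def power2_eq_square algebra_simps u_def flip: exp_add)
  also have "\<dots> \<le> exp (c * s\<^sup>2) * exp (u / 2) * exp ((2 * c * s * q)\<^sup>2 / 2)"
    by (intro mult_left_mono cosh_le_exp_half_square) auto
  also have "\<dots> = exp (c * s\<^sup>2 * (1 + u)) * exp (u / 2)"
    by (simp add: power2_eq_square algebra_simps u_def flip: exp_add)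
  also have "\<dots> \<le> exp (c * s\<^sup>2 / (1 - u)) * (1 / sqrt (1 - u))"
  proof (intro mult_mono)
    have "(1 + u) * (1 - u) \<le> 1" by (simp add: algebra_simps)
    then have "1 + u \<le> 1 / (1 - u)" using u by (simp add: field_simps)
    then have "(c * s\<^sup>2) * (1 + u) \<le> (c * s\<^sup>2) * (1 / (1 - u))"
      using assms by (intro mult_left_mono) auto
    then show "exp (c * s\<^sup>2 * (1 + u)) \<le> exp (c * s\<^sup>2 / (1 - u))" by simp
    have "1 - u \<le> exp (- u)" using exp_ge_add_one_self[of "- u"] by simp
    then have "sqrt (1 - u) \<le> sqrt (exp (- u))" by simp
    also have "\<dots> = exp (- (u / 2))"
      by (rule real_sqrt_unique) (auto simp: power2_eq_square simp flip: exp_add)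
    finally have "sqrt (1 - u) * exp (u / 2) \<le> exp (- (u / 2)) * exp (u / 2)"
      by (intro mult_right_mono) auto
    then show "exp (u / 2) \<le> 1 / sqrt (1 - u)"
      using u by (simp add: field_simps flip: exp_add)
  qed auto
  finally show ?thesis by (simp add: u_def)
qed

text \<open>
  The signs are exchanged for normal variables one at a time; after the induction hypothesis has
  integrated out those of \<open>I\<close>, the constant \<open>c\<close> has become \<open>c / (1 - 2 * c * r)\<close> with \<open>r\<close> the variance spent.
\<close>

lemma sign_mean_exp_square:
  assumes "finite I" "0 \<le> c" "2 * c * (\<Sum>i\<in>I. (a i)\<^sup>2) < 1"
  shows "sign_mean I (\<lambda>A. exp (c * (s + signed_sum I a A)\<^sup>2))
    \<le> exp (c * s\<^sup>2 / (1 - 2 * c * (\<Sum>i\<in>I. (a i)\<^sup>2))) / sqrt (1 - 2 * c * (\<Sum>i\<in>I. (a i)\<^sup>2))"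
  using assms(1,3)
proof (induction I arbitrary: s)
  case (insert i I)
  define r where "r = (\<Sum>i\<in>I. (a i)\<^sup>2)"
  define w where "w = 1 - 2 * c * r"
  have w: "2 * c * (a i)\<^sup>2 < w" and w0: "0 < w"
  proof -
    show *: "2 * c * (a i)\<^sup>2 < w" using insert.prems insert.hyps by (simp add: w_def r_def algebra_simps)
    have "0 \<le> 2 * c * (a i)\<^sup>2" using assms by simp
    with * show "0 < w" by linarith
  qed
  define d where "d = c / w"
  have d: "0 \<le> d" "2 * d * (a i)\<^sup>2 < 1" using w w0 assms by (auto simp: d_def field_simps)
  have IH: "sign_mean I (\<lambda>A. exp (c * (t + signed_sum I a A)\<^sup>2)) \<le> exp (d * t\<^sup>2) / sqrt w" for t
    using insert.IH[of t] w0 by (simp add: r_def[symmetric] w_def d_def)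
  have "sign_mean (insert i I) (\<lambda>A. exp (c * (s + signed_sum (insert i I) a A)\<^sup>2))
    = (sign_mean I (\<lambda>A. exp (c * ((s + a i) + signed_sum I a A)\<^sup>2))
       + sign_mean I (\<lambda>A. exp (c * ((s - a i) + signed_sum I a A)\<^sup>2))) / 2"
    by (simp add: sign_mean_insert[OF insert.hyps, where f = "\<lambda>r. exp (c * (s + r)\<^sup>2)"] algebra_simps)
  also have "\<dots> \<le> ((exp (d * (s + a i)\<^sup>2) + exp (d * (s - a i)\<^sup>2)) / 2) / sqrt w"
    using IH[of "s + a i"] IH[of "s - a i"] by (simp add: add_divide_distrib)
  also have "\<dots> \<le> (exp (d * s\<^sup>2 / (1 - 2 * d * (a i)\<^sup>2)) / sqrt (1 - 2 * d * (a i)\<^sup>2)) / sqrt w"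
    using w0 by (intro divide_right_mono gaussian_step d) auto
  also have "\<dots> = exp (d * s\<^sup>2 / (1 - 2 * d * (a i)\<^sup>2)) / sqrt (w * (1 - 2 * d * (a i)\<^sup>2))"
    by (simp add: real_sqrt_mult)
  also have "w * (1 - 2 * d * (a i)\<^sup>2) = 1 - 2 * c * (\<Sum>i\<in>insert i I. (a i)\<^sup>2)"
    using w0 insert.hyps by (simp add: d_def w_def r_def field_simps)
  also have "d * s\<^sup>2 / (1 - 2 * d * (a i)\<^sup>2) = c * s\<^sup>2 / (w * (1 - 2 * d * (a i)\<^sup>2))"
    using w0 by (simp add: d_def)
  also have "w * (1 - 2 * d * (a i)\<^sup>2) = 1 - 2 * c * (\<Sum>i\<in>insert i I. (a i)\<^sup>2)"
    using w0 insert.hyps by (simp add: d_def w_def r_def field_simps)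
  finally show ?case .
qed simp

text \<open>
  At least one of \<open>s + r\<close>, \<open>s - r\<close> lies in \<open>[-1, 1]\<close> as soon as \<open>\<bar>r\<bar> \<le> 1 + \<bar>s\<bar>\<close>. The sum \<open>r\<close> is symmetric, so the
  probability in question is at least half of the probability of \<open>\<bar>r\<bar> \<le> 1 + \<bar>s\<bar>\<close>, which Chebyshev's inequality
  bounds.
\<close>

section \<open>A Rademacher sum of variance at most one is often at most one\<close>

lemma sign_mean_small_ball_Chebyshev:
  assumes "finite I" "\<bar>s\<bar> \<le> 1"
  shows "(1 - (\<Sum>i\<in>I. (a i)\<^sup>2) / (1 + \<bar>s\<bar>)\<^sup>2) / 2
    \<le> sign_mean I (\<lambda>A. of_bool (\<bar>s + signed_sum I a A\<bar> \<le> 1))"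
proof -
  let ?R = "signed_sum I a"
  define c where "c = 1 + \<bar>s\<bar>"
  have c: "c > 0" unfolding c_def by simp
  have "1 - (\<Sum>i\<in>I. (a i)\<^sup>2) / c\<^sup>2 = sign_mean I (\<lambda>A. 1 - (1 / c\<^sup>2) * (0 + ?R A)\<^sup>2)"
    using sign_mean_add[of I "\<lambda>A. 1" "\<lambda>A. (- (1 / c\<^sup>2)) * (0 + ?R A)\<^sup>2"]
    by (simp only: sign_mean_cmult sign_mean_const sign_mean_square assms) simp
  also have "\<dots> \<le> sign_mean I (\<lambda>A. of_bool (\<bar>s + ?R A\<bar> \<le> 1) + of_bool (\<bar>s + - ?R A\<bar> \<le> 1))"
  proof (rule sign_mean_mono)
    fix A
    \<comment> \<open>Chebyshev's inequality and the choice between the two signs of \<open>?R A\<close>, pointwise.\<close>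
    show "1 - (1 / c\<^sup>2) * (0 + ?R A)\<^sup>2 \<le> of_bool (\<bar>s + ?R A\<bar> \<le> 1) + of_bool (\<bar>s + - ?R A\<bar> \<le> 1)"
    proof (cases "\<bar>?R A\<bar> \<le> c")
      case True
      then have "\<bar>s + ?R A\<bar> \<le> 1 \<or> \<bar>s + - ?R A\<bar> \<le> 1"
        using assms unfolding c_def by linarith
      then have "(1::real) \<le> of_bool (\<bar>s + ?R A\<bar> \<le> 1) + of_bool (\<bar>s + - ?R A\<bar> \<le> 1)"
        by auto
      moreover have "0 \<le> (1 / c\<^sup>2) * (0 + ?R A)\<^sup>2" by simp
      ultimately show ?thesis by linarith
    next
      case False
      then have "c\<^sup>2 \<le> (?R A)\<^sup>2" using c by (simp add: abs_le_square_iff[symmetric])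
      then have "1 \<le> (1 / c\<^sup>2) * (0 + ?R A)\<^sup>2" using c by (simp add: field_simps)
      moreover have "(0::real) \<le> of_bool (\<bar>s + ?R A\<bar> \<le> 1) + of_bool (\<bar>s + - ?R A\<bar> \<le> 1)"
        by simp
      ultimately show ?thesis by linarith
    qed
  qed
  also have "\<dots> = 2 * sign_mean I (\<lambda>A. of_bool (\<bar>s + ?R A\<bar> \<le> 1))"
    using sign_mean_reflect[OF assms(1), of "\<lambda>r. of_bool (\<bar>s + r\<bar> \<le> 1)" a]
    by (simp add: sign_mean_add)
  finally show ?thesis by (simp add: c_def)
qed

text \<open>
  Reveal the signs one by one, starting from a partial sum \<open>s\<close>, as long as the next step cannot leave
  \<open>[-1, 1]\<close>. When the next step \<open>q\<close> could leave, \<open>\<bar>s\<bar> > 1 - q\<close>, while the remaining variance is at most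
  \<open>1 - M\<^sup>2 \<le> 1 - q\<^sup>2\<close>, where \<open>M\<close> accounts for a summand that is already spent and dominates all the others.
  Chebyshev then gives \<open>(1 - (1 - q\<^sup>2) / (2 - q)\<^sup>2) / 2\<close>, whose minimum, at \<open>q = 1 / 2\<close>, is \<open>1 / 3\<close>.
\<close>

lemma sign_mean_small_ball_stopped:
  assumes "finite I" "\<bar>s\<bar> \<le> 1" "\<And>i. i \<in> I \<Longrightarrow> \<bar>a i\<bar> \<le> M" "M\<^sup>2 + (\<Sum>i\<in>I. (a i)\<^sup>2) \<le> 1"
  shows "1 / 3 \<le> sign_mean I (\<lambda>A. of_bool (\<bar>s + signed_sum I a A\<bar> \<le> 1))"
  using assms
proof (induction I arbitrary: s)
  case empty
  then show ?case by simp
next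
  case (insert i I)
  define q where "q = \<bar>a i\<bar>"
  have qM: "0 \<le> q" "q \<le> M" using insert.prems(2) by (auto simp: q_def)
  show ?case
  proof (cases "\<bar>s\<bar> + q \<le> 1")
    case True
    have "M\<^sup>2 + (\<Sum>i\<in>I. (a i)\<^sup>2) \<le> M\<^sup>2 + (\<Sum>i\<in>insert i I. (a i)\<^sup>2)"
      using insert.hyps by simp
    then have v: "M\<^sup>2 + (\<Sum>i\<in>I. (a i)\<^sup>2) \<le> 1" using insert.prems(3) by linarith
    have "1 / 3 \<le> sign_mean I (\<lambda>A. of_bool (\<bar>s + a i + signed_sum I a A\<bar> \<le> 1))"
      using True v insert.prems(2) by (intro insert.IH) (auto simp: q_def)
    moreover have "1 / 3 \<le> sign_mean I (\<lambda>A. of_bool (\<bar>s + - a i + signed_sum I a A\<bar> \<le> 1))"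
      using True v insert.prems(2) by (intro insert.IH) (auto simp: q_def)
    ultimately show ?thesis
      by (simp add: sign_mean_insert[OF insert.hyps, where f = "\<lambda>r. of_bool (\<bar>s + r\<bar> \<le> 1)"] algebra_simps)
  next
    case False
    define v where "v = (\<Sum>i\<in>insert i I. (a i)\<^sup>2)"
    have "q\<^sup>2 \<le> M\<^sup>2" using qM by (intro power_mono)
    then have v: "v \<le> 1 - q\<^sup>2" using insert.prems(3) by (simp add: v_def)
    have "(a i)\<^sup>2 \<le> v" using insert.hyps by (simp add: v_def sum_nonneg)
    then have "q\<^sup>2 + q\<^sup>2 \<le> 1" using v by (simp add: q_def)
    then have "q\<^sup>2 \<le> 1\<^sup>2" by (smt (verit) one_power2 zero_le_power2)
    then have q1: "q \<le> 1" by (rule power2_le_imp_le) simp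
    have "(2 - q)\<^sup>2 \<le> (1 + \<bar>s\<bar>)\<^sup>2" using False q1 by (intro power_mono) auto
    moreover have "3 * (1 - q\<^sup>2) \<le> (2 - q)\<^sup>2"
    proof -
      \<comment> \<open>Equality at \<open>q = 1 / 2\<close> is where the constant \<open>1 / 3\<close> comes from.\<close>
      have "(2 - q)\<^sup>2 - 3 * (1 - q\<^sup>2) = (1 - 2 * q)\<^sup>2" by (simp add: power2_eq_square algebra_simps)
      then show ?thesis by (smt (verit) zero_le_power2)
    qed
    moreover have "3 * v \<le> 3 * (1 - q\<^sup>2)" using v by simp
    ultimately have "3 * v \<le> (1 + \<bar>s\<bar>)\<^sup>2" by (meson order_trans)
    then have "v / (1 + \<bar>s\<bar>)\<^sup>2 \<le> 1 / 3" by (simp add: field_simps add_pos_nonneg)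
    then have "1 / 3 \<le> (1 - v / (1 + \<bar>s\<bar>)\<^sup>2) / 2" by simp
    also have "\<dots> \<le> sign_mean (insert i I) (\<lambda>A. of_bool (\<bar>s + signed_sum (insert i I) a A\<bar> \<le> 1))"
      unfolding v_def using insert.hyps insert.prems(1)
      by (intro sign_mean_small_ball_Chebyshev) auto
    finally show ?thesis .
  qed
qed

text \<open>
  Spending the largest coefficient first supplies the bound \<open>M\<close> for the stopping argument.
\<close>

lemma sign_mean_small_ball:
  assumes "finite I" "(\<Sum>i\<in>I. (a i)\<^sup>2) \<le> 1"
  shows "1 / 3 \<le> sign_mean I (\<lambda>A. of_bool (\<bar>signed_sum I a A\<bar> \<le> 1))"
proof (cases "I = {}")
  case True
  then show ?thesis by simp
next
  case False
  let ?m = "Max ((\<lambda>j. \<bar>a j\<bar>) ` I)"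
  have "?m \<in> (\<lambda>j. \<bar>a j\<bar>) ` I" using assms(1) False by (intro Max_in) auto
  then obtain i where "i \<in> I" "\<bar>a i\<bar> = ?m" by auto
  then have i: "i \<in> I" "\<And>j. j \<in> I \<Longrightarrow> \<bar>a j\<bar> \<le> \<bar>a i\<bar>"
    using assms(1) by auto
  define J where "J = I - {i}"
  have J: "finite J" "i \<notin> J" "I = insert i J" using assms(1) i by (auto simp: J_def)
  have sq: "(a i)\<^sup>2 + (\<Sum>j\<in>J. (a j)\<^sup>2) \<le> 1" using assms(2) J by simp
  then have "(a i)\<^sup>2 \<le> 1\<^sup>2" by (smt (verit) one_power2 sum_nonneg zero_le_power2)
  then have "\<bar>a i\<bar> \<le> 1" by (simp add: abs_square_le_1)
  then have "1 / 3 \<le> sign_mean J (\<lambda>A. of_bool (\<bar>e + signed_sum J a A\<bar> \<le> 1))" if "\<bar>e\<bar> = \<bar>a i\<bar>" for e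
    using J i sq that by (intro sign_mean_small_ball_stopped[where M = "\<bar>a i\<bar>"]) auto
  from this[of "a i"] this[of "- a i"] show ?thesis
    by (simp add: J(3) sign_mean_insert[OF J(1,2), where f = "\<lambda>r. of_bool (\<bar>r\<bar> \<le> 1)"])
qed

text \<open>
  Write the exponent as a convex combination of the normalized squares \<open>(signed_sum I (b l) A)\<^sup>2 / (3 * r l)\<close> with
  weights \<open>r l / p\<close>, where \<open>r l\<close> is the variance of the \<open>l\<close>-th sum and \<open>p\<close> the total. By Jensen's inequality one
  square is enough, and there the factor \<open>1 / 3\<close> gives \<open>1 / sqrt (1 - 2 / 3) = sqrt 3\<close>.
\<close>

lemma sign_mean_exp_sum_squares:
  assumes I: "finite I" and L: "finite L"
  shows "sign_mean I (\<lambda>A. exp ((\<Sum>l\<in>L. (signed_sum I (b l) A)\<^sup>2) / (3 * (\<Sum>l\<in>L. \<Sum>i\<in>I. (b l i)\<^sup>2)))) \<le> sqrt 3"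
proof -
  define r where "r l = (\<Sum>i\<in>I. (b l i)\<^sup>2)" for l
  define p where "p = (\<Sum>l\<in>L. r l)"
  have r: "0 \<le> r l" for l by (simp add: r_def sum_nonneg)
  have sqrt3: "1 \<le> sqrt 3" by simp
  show ?thesis
  proof (cases "p = 0")
    case True
    then show ?thesis using I by (simp add: p_def[unfolded r_def] sign_mean_const)
  next
    case False
    then have p: "p > 0" using r sum_nonneg[of L r] by (simp add: p_def)
    \<comment> \<open>A sum of variance \<open>0\<close> vanishes; there \<open>?c l = 1 / 0 = 0\<close>, so that its weight and its square are both \<open>0\<close>.\<close>
    let ?c = "\<lambda>l. 1 / (3 * r l)"
    let ?x = "\<lambda>l A. ?c l * (0 + signed_sum I (b l) A)\<^sup>2"
    have zero: "signed_sum I (b l) A = 0" if "r l = 0" for l A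
      using that I by (simp add: r_def signed_sum_def sum_nonneg_eq_0_iff)
    have single: "sign_mean I (\<lambda>A. exp (?x l A)) \<le> sqrt 3" for l
    proof (cases "r l = 0")
      case True
      then show ?thesis using I sqrt3 by (simp add: sign_mean_const)
    next
      case False
      then have eq: "1 - 2 * ?c l * (\<Sum>i\<in>I. (b l i)\<^sup>2) = 1 / 3" by (simp add: r_def[symmetric])
      then have "2 * ?c l * (\<Sum>i\<in>I. (b l i)\<^sup>2) < 1" by linarith
      from sign_mean_exp_square[OF I _ this, of 0, unfolded eq] r[of l]
      show ?thesis by (simp add: real_sqrt_divide)
    qed
    have "exp ((\<Sum>l\<in>L. (signed_sum I (b l) A)\<^sup>2) / (3 * p)) \<le> (\<Sum>l\<in>L. (r l / p) * exp (?x l A))" for A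
    proof -
      have "(\<Sum>l\<in>L. (signed_sum I (b l) A)\<^sup>2) / (3 * p) = (\<Sum>l\<in>L. (r l / p) *\<^sub>R ?x l A)"
        unfolding sum_divide_distrib
      proof (rule sum.cong[OF refl])
        fix l
        show "(signed_sum I (b l) A)\<^sup>2 / (3 * p) = (r l / p) *\<^sub>R ?x l A"
          using zero[of l A] by (cases "r l = 0") auto
      qed
      moreover have "exp (\<Sum>l\<in>L. (r l / p) *\<^sub>R ?x l A) \<le> (\<Sum>l\<in>L. (r l / p) * exp (?x l A))"
        using p r L False
        by (intro convex_on_sum[OF _ _ exp_convex])
          (auto simp: p_def simp flip: sum_divide_distrib)
      ultimately show ?thesis by simp
    qed
    then have "sign_mean I (\<lambda>A. exp ((\<Sum>l\<in>L. (signed_sum I (b l) A)\<^sup>2) / (3 * p)))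
        \<le> sign_mean I (\<lambda>A. \<Sum>l\<in>L. (r l / p) * exp (?x l A))"
      by (rule sign_mean_mono)
    also have "\<dots> = (\<Sum>l\<in>L. (r l / p) * sign_mean I (\<lambda>A. exp (?x l A)))"
      by (simp only: sign_mean_sum sign_mean_cmult)
    also have "\<dots> \<le> (\<Sum>l\<in>L. (r l / p) * sqrt 3)"
      using r p by (intro sum_mono mult_left_mono single) auto
    also have "\<dots> = sqrt 3"
      using p by (simp add: p_def flip: sum_distrib_right sum_divide_distrib)
    finally show ?thesis by (simp add: p_def r_def)
  qed
qed

text \<open>
  Markov's inequality for the exponential moment.
\<close>

lemma sign_mean_sum_squares_tail:
  assumes I: "finite I" and L: "finite L"
    and bound: "(\<Sum>l\<in>L. \<Sum>i\<in>I. (b l i)\<^sup>2) \<le> c" and c: "0 < c" and g: "0 \<le> g"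
  shows "sign_mean I (\<lambda>A. of_bool ((\<Sum>l\<in>L. (signed_sum I (b l) A)\<^sup>2) > g * c)) \<le> sqrt 3 * exp (- (g / 3))"
proof -
  define p where "p = (\<Sum>l\<in>L. \<Sum>i\<in>I. (b l i)\<^sup>2)"
  let ?Q = "\<lambda>A. \<Sum>l\<in>L. (signed_sum I (b l) A)\<^sup>2"
  have p0: "0 \<le> p" by (simp add: p_def sum_nonneg)
  have "of_bool (?Q A > g * c) \<le> exp (- (g / 3)) * exp (?Q A / (3 * p))" for A
  proof (cases "?Q A > g * c")
    case True
    have "p \<noteq> 0"
    proof
      assume "p = 0"
      then have "\<forall>l\<in>L. \<forall>i\<in>I. b l i = 0"
        using I L by (simp add: p_def sum_nonneg_eq_0_iff sum_nonneg)
      then have "?Q A = 0" by (simp add: signed_sum_def)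
      with True c g show False by (simp add: mult_less_0_iff)
    qed
    with p0 have "p > 0" by simp
    have "g * p \<le> g * c" using bound g by (intro mult_left_mono) (auto simp: p_def)
    with True have "g * p < ?Q A" by linarith
    then have "g / 3 \<le> ?Q A / (3 * p)" using \<open>p > 0\<close> by (simp add: field_simps)
    then have "1 \<le> exp (- (g / 3)) * exp (?Q A / (3 * p))" by (simp flip: exp_add)
    then show ?thesis by (simp add: True)
  qed simp
  then have "sign_mean I (\<lambda>A. of_bool (?Q A > g * c)) \<le> sign_mean I (\<lambda>A. exp (- (g / 3)) * exp (?Q A / (3 * p)))"
    by (rule sign_mean_mono)
  also have "\<dots> \<le> exp (- (g / 3)) * sqrt 3"
    unfolding sign_mean_cmult p_def by (intro mult_left_mono sign_mean_exp_sum_squares I L) simp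
  finally show ?thesis by (simp add: mult.commute)
qed

section \<open>Positive semidefinite matrices as sums of outer products\<close>

definition outer :: "real^'n \<Rightarrow> real^'n^'n" where
  "outer v = (\<chi> i j. v $ i * v $ j)"

lemma inner_real_vec: "x \<bullet> y = (\<Sum>l\<in>UNIV. x $ l * y $ l)" for x y :: "real^'l"
  by (simp add: inner_vec_def)

text \<open>
  The inner product of matrices is the trace form, so a matrix \<open>V\<close> in the second argument of \<open>A \<bullet> V\<close> plays the
  role of a second-moment matrix, and \<open>outer v\<close> is the one concentrated at \<open>v\<close>.
\<close>

lemma inner_outer: "A \<bullet> outer v = v \<bullet> (A *v v)"
  by (simp add: outer_def inner_vec_def matrix_vector_mult_def sum_distrib_left ac_simps)

lemma inner_outer_outer: "outer u \<bullet> outer v = (u \<bullet> v)\<^sup>2"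
proof -
  have "outer u *v v = (u \<bullet> v) *\<^sub>R u"
    by (simp add: outer_def matrix_vector_mult_def inner_vec_def vec_eq_iff sum_distrib_right sum_distrib_left ac_simps)
  then show ?thesis by (simp add: inner_outer power2_eq_square inner_commute)
qed

lemma psd_zero: "psd (0 :: real^'n^'n)"
  by (simp add: psd_def sym_mat_def transpose_def vec_eq_iff)

lemma psd_scaled_outer:
  assumes "0 \<le> r"
  shows "psd (r *\<^sub>R outer v)"
proof -
  have "w \<bullet> ((r *\<^sub>R outer v) *v w) = r * (v \<bullet> w)\<^sup>2" for w
    by (simp add: inner_outer_outer flip: inner_outer)
  with assms show ?thesis
    by (simp add: psd_def) (simp add: sym_mat_def outer_def transpose_def vec_eq_iff mult.commute)
qed

lemma psd_convex_combination:
  assumes "psd A" "psd B" "0 \<le> a" "0 \<le> b"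
  shows "psd (a *\<^sub>R A + b *\<^sub>R B)"
proof -
  have "w \<bullet> ((a *\<^sub>R A + b *\<^sub>R B) *v w) = a * (w \<bullet> (A *v w)) + b * (w \<bullet> (B *v w))" for w
    by (simp add: inner_simps flip: inner_outer)
  with assms show ?thesis
    by (simp add: psd_def) (simp add: sym_mat_def transpose_def vec_eq_iff)
qed

lemma psd_eq_sum_outer:
  fixes V :: "real^'n^'n"
  assumes "psd V"
  obtains y :: "'n \<Rightarrow> real^'n" where "V = (\<Sum>i\<in>UNIV. outer (y i))"
proof -
  obtain u :: "'n \<Rightarrow> real^'n" and d where u: "\<And>i j. u i \<bullet> u j = (if i = j then 1 else 0)"
    and d: "\<And>i. V *v u i = d i *\<^sub>R u i"
    using sym_mat_spectral assms unfolding psd_def by blast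
  have d0: "0 \<le> d i" for i
  proof -
    have "0 \<le> u i \<bullet> (V *v u i)" using assms unfolding psd_def by blast
    then show ?thesis by (simp add: d u)
  qed
  have "V = (\<Sum>i\<in>UNIV. outer (sqrt (d i) *\<^sub>R u i))"
    using d0 by (simp add: vec_eq_iff outer_def spectral_expansion[OF u d] algebra_simps)
      (simp flip: mult.assoc)
  then show ?thesis by (rule that)
qed

lemma psd_inner_nonneg:
  fixes A B :: "real^'n^'n"
  assumes "psd A" "psd B"
  shows "0 \<le> A \<bullet> B"
proof -
  obtain y :: "'n \<Rightarrow> real^'n" where "B = (\<Sum>i\<in>UNIV. outer (y i))" by (rule psd_eq_sum_outer[OF assms(2)])
  then show ?thesis
    using assms(1) by (simp add: inner_sum_right inner_outer psd_def sum_nonneg)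
qed

section \<open>Semidefinite duality\<close>

lemma dominated_by_all_multiples:
  fixes b c :: real
  assumes "\<And>t. 0 < t \<Longrightarrow> c \<le> t * b"
  shows "0 \<le> b" "c \<le> 0"
proof -
  show "0 \<le> b"
  proof (rule ccontr)
    assume "\<not> 0 \<le> b"
    then have "c \<le> ((\<bar>c\<bar> + 1) / (- b)) * b" by (intro assms) (auto simp: field_simps)
    then show False using \<open>\<not> 0 \<le> b\<close> by simp
  qed
  show "c \<le> 0"
  proof (rule ccontr)
    assume "\<not> c \<le> 0"
    then have "c \<le> (c / (2 * (b + 1))) * b" using \<open>0 \<le> b\<close> by (intro assms) auto
    then have "2 * (b + 1) * c \<le> c * b" using \<open>0 \<le> b\<close> by (simp add: field_simps)
    moreover have "0 \<le> c * b" using \<open>\<not> c \<le> 0\<close> \<open>0 \<le> b\<close> by simp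
    ultimately show False using \<open>\<not> c \<le> 0\<close> by (simp add: algebra_simps)
  qed
qed

text \<open>
  Strong duality for maximizing \<open>W \<bullet> V\<close> over semidefinite \<open>V\<close> with \<open>A l \<bullet> V \<le> r $ l\<close> for some \<open>r\<close> in \<open>R\<close>, as an alternative.
  The pairs \<open>(w, s)\<close> strictly below \<open>(W \<bullet> V - \<xi>, r - A \<bullet> V)\<close> form a convex set, and a primal certificate exists
  exactly when this set contains the origin. Otherwise a hyperplane separates it from the origin, and
  the normal vector is the multiplier. The point \<open>V = 0\<close>, \<open>r = r0\<close> satisfies all the constraints strictly, and
  therefore the normal vector has a nonzero objective component.
\<close>

theorem semidefinite_alternative:
  fixes W :: "real^'n^'n" and A :: "'l::finite \<Rightarrow> real^'n^'n" and R :: "(real^'l) set"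
  assumes R: "convex R" and r0: "r0 \<in> R" "\<And>l. 0 < r0 $ l"
  obtains (dual) \<mu> :: "real^'l" where "\<And>l. 0 \<le> \<mu> $ l"
      "\<And>y. y \<bullet> (W *v y) \<le> (\<Sum>l\<in>UNIV. \<mu> $ l * (y \<bullet> (A l *v y)))" "\<And>r. r \<in> R \<Longrightarrow> \<mu> \<bullet> r \<le> \<xi>"
    | (primal) V r where "psd V" "r \<in> R" "\<And>l. A l \<bullet> V < r $ l" "\<xi> < W \<bullet> V"
proof -
  define C :: "(real \<times> (real^'l)) set" where
    "C = {(w, s). \<exists>V r. psd V \<and> r \<in> R \<and> w < W \<bullet> V - \<xi> \<and> (\<forall>l. s $ l < r $ l - A l \<bullet> V)}"
  show ?thesis
  proof (cases "0 \<in> C")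
    case True
    then show ?thesis using primal by (auto simp: C_def zero_prod_def)
  next
    case False
    have "convex C"
    proof (rule convexI)
      fix x y :: "real \<times> (real^'l)" and a b :: real
      assume xy: "x \<in> C" "y \<in> C" and ab: "0 \<le> a" "0 \<le> b" "a + b = 1"
      have less: "a * p + b * q < a * p' + b * q'" if "p < p'" "q < q'" for p q p' q' :: real
        using ab that by (cases "a = 0") (auto intro!: add_less_le_mono mult_left_mono)
      from xy obtain V r V' r' where V: "psd V" "r \<in> R" "fst x < W \<bullet> V - \<xi>" "\<And>l. snd x $ l < r $ l - A l \<bullet> V"
        and V': "psd V'" "r' \<in> R" "fst y < W \<bullet> V' - \<xi>" "\<And>l. snd y $ l < r' $ l - A l \<bullet> V'"
        by (auto simp: C_def)
      let ?V = "a *\<^sub>R V + b *\<^sub>R V'" and ?r = "a *\<^sub>R r + b *\<^sub>R r'"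
      have "psd ?V" using V V' ab by (intro psd_convex_combination) auto
      moreover have "?r \<in> R" using R V V' ab by (simp add: convexD)
      moreover have "a * fst x + b * fst y < W \<bullet> ?V - \<xi>"
      proof -
        have "a * fst x + b * fst y < a * (W \<bullet> V - \<xi>) + b * (W \<bullet> V' - \<xi>)" by (intro less V V')
        also have "\<dots> = W \<bullet> ?V - (a + b) * \<xi>" by (simp add: inner_simps algebra_simps)
        finally show ?thesis using ab by simp
      qed
      moreover have "a * snd x $ l + b * snd y $ l < ?r $ l - A l \<bullet> ?V" for l
      proof -
        have "a * snd x $ l + b * snd y $ l < a * (r $ l - A l \<bullet> V) + b * (r' $ l - A l \<bullet> V')"
          by (intro less V V')
        also have "\<dots> = ?r $ l - A l \<bullet> ?V" by (simp add: inner_simps algebra_simps)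
        finally show ?thesis .
      qed
      ultimately show "a *\<^sub>R x + b *\<^sub>R y \<in> C"
        unfolding C_def by (auto simp: case_prod_beta intro!: exI[of _ ?V] exI[of _ ?r])
    qed
    from separating_hyperplane_set_0[OF this False] obtain a where
      a: "a \<noteq> 0" "\<And>x. x \<in> C \<Longrightarrow> 0 \<le> a \<bullet> x" by blast
    define \<beta> where "\<beta> = - fst a"
    define \<nu> where "\<nu> = - snd a"
    \<comment> \<open>The slacks \<open>e\<close> and \<open>f\<close> are arbitrary positive numbers: letting all of them tend to \<open>0\<close> gives the Lagrange
      inequality, letting one tend to infinity gives the sign of the corresponding multiplier.\<close>
    have sep: "\<beta> * (W \<bullet> V - \<xi>) + (\<Sum>l\<in>UNIV. \<nu> $ l * (r $ l - A l \<bullet> V)) \<le> e * \<beta> + (\<Sum>l\<in>UNIV. \<nu> $ l * f l)"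
      if "psd V" "r \<in> R" "0 < e" "\<And>l. 0 < f l" for V r e f
    proof -
      have "(W \<bullet> V - \<xi> - e, \<chi> l. r $ l - A l \<bullet> V - f l) \<in> C"
        unfolding C_def using that by (auto intro!: exI[of _ V] exI[of _ r])
      from a(2)[OF this] show ?thesis
        by (simp add: \<beta>_def \<nu>_def inner_prod_def inner_real_vec sum.distrib sum_subtractf sum_negf algebra_simps)
    qed
    have lagr: "\<beta> * (W \<bullet> V - \<xi>) + (\<Sum>l\<in>UNIV. \<nu> $ l * (r $ l - A l \<bullet> V)) \<le> 0" if "psd V" "r \<in> R" for V r
    proof (rule dominated_by_all_multiples(2))
      fix t :: real assume "0 < t"
      from sep[OF that this, of "\<lambda>_. t"] this
      show "\<beta> * (W \<bullet> V - \<xi>) + (\<Sum>l\<in>UNIV. \<nu> $ l * (r $ l - A l \<bullet> V)) \<le> t * (\<beta> + (\<Sum>l\<in>UNIV. \<nu> $ l))"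
        by (simp add: sum_distrib_left algebra_simps)
    qed
    have \<beta>0: "0 \<le> \<beta>"
    proof (rule dominated_by_all_multiples(1))
      fix t :: real assume "0 < t"
      from sep[OF psd_zero r0(1) this, of "\<lambda>_. 1"]
      show "\<beta> * (- \<xi>) + (\<Sum>l\<in>UNIV. \<nu> $ l * r0 $ l) - (\<Sum>l\<in>UNIV. \<nu> $ l) \<le> t * \<beta>" by simp
    qed
    have \<nu>0: "0 \<le> \<nu> $ k" for k
    proof (rule dominated_by_all_multiples(1))
      fix t :: real assume "0 < t"
      then have "\<beta> * (- \<xi>) + (\<Sum>l\<in>UNIV. \<nu> $ l * r0 $ l)
          \<le> \<beta> + (\<Sum>l\<in>UNIV. \<nu> $ l * (if l = k then t else 1))"
        using sep[OF psd_zero r0(1), of 1 "\<lambda>l. if l = k then t else 1"] by simp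
      also have "(\<Sum>l\<in>UNIV. \<nu> $ l * (if l = k then t else 1)) = \<nu> $ k * t + (\<Sum>l\<in>UNIV - {k}. \<nu> $ l)"
        by (simp add: sum.remove[of _ k])
      finally show "\<beta> * (- \<xi>) + (\<Sum>l\<in>UNIV. \<nu> $ l * r0 $ l) - \<beta> - (\<Sum>l\<in>UNIV - {k}. \<nu> $ l) \<le> t * \<nu> $ k"
        by (simp add: mult.commute)
    qed
    \<comment> \<open>At \<open>V = 0\<close>, \<open>r = r0\<close> all slacks are positive, so a normal vector with \<open>\<beta> = 0\<close> would be \<open>0\<close>.\<close>
    have "\<beta> \<noteq> 0"
    proof
      assume "\<beta> = 0"
      then have "(\<Sum>l\<in>UNIV. \<nu> $ l * r0 $ l) \<le> 0" using lagr[OF psd_zero r0(1)] by simp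
      moreover have "0 \<le> \<nu> $ l * r0 $ l" for l using \<nu>0 r0(2)[of l] by simp
      ultimately have "(\<Sum>l\<in>UNIV. \<nu> $ l * r0 $ l) = 0" by (meson antisym sum_nonneg)
      then have "\<forall>l. \<nu> $ l * r0 $ l = 0"
        using \<open>\<And>l. 0 \<le> \<nu> $ l * r0 $ l\<close> by (simp add: sum_nonneg_eq_0_iff)
      then have "\<nu> = 0" using r0(2) by (auto simp: vec_eq_iff) (metis less_irrefl)
      with \<open>\<beta> = 0\<close> a(1) show False by (simp add: \<beta>_def \<nu>_def prod_eq_iff)
    qed
    with \<beta>0 have \<beta>: "0 < \<beta>" by simp
    show ?thesis
    proof (rule dual[of "(1 / \<beta>) *\<^sub>R \<nu>"])
      show "0 \<le> ((1 / \<beta>) *\<^sub>R \<nu>) $ l" for l using \<beta> \<nu>0 by simp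
      show "((1 / \<beta>) *\<^sub>R \<nu>) \<bullet> r \<le> \<xi>" if "r \<in> R" for r
        using lagr[OF psd_zero that] \<beta> by (simp add: inner_real_vec field_simps flip: sum_divide_distrib)
      fix y
      \<comment> \<open>Along the ray of multiples of \<open>outer y\<close> the Lagrangian stays bounded above, so its slope is at most \<open>0\<close>.\<close>
      have "0 \<le> (\<Sum>l\<in>UNIV. \<nu> $ l * (y \<bullet> (A l *v y))) - \<beta> * (y \<bullet> (W *v y))"
      proof (rule dominated_by_all_multiples(1))
        fix t :: real assume "0 < t"
        then have "psd (t *\<^sub>R outer y)" by (intro psd_scaled_outer) simp
        from lagr[OF this r0(1)]
        show "(\<Sum>l\<in>UNIV. \<nu> $ l * r0 $ l) - \<beta> * \<xi> \<le> t * ((\<Sum>l\<in>UNIV. \<nu> $ l * (y \<bullet> (A l *v y))) - \<beta> * (y \<bullet> (W *v y)))"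
          by (simp add: inner_outer right_diff_distrib sum_subtractf sum_distrib_left ac_simps)
      qed
      then show "y \<bullet> (W *v y) \<le> (\<Sum>l\<in>UNIV. ((1 / \<beta>) *\<^sub>R \<nu>) $ l * (y \<bullet> (A l *v y)))"
        using \<beta> by (simp add: field_simps flip: sum_divide_distrib)
    qed
  qed
qed

section \<open>Rounding a semidefinite matrix to a vector\<close>

lemma bilinear_sum:
  fixes A :: "real^'n^'n" and y :: "'i \<Rightarrow> real^'n"
  shows "(\<Sum>i\<in>I. a i *\<^sub>R y i) \<bullet> (A *v (\<Sum>j\<in>J. b j *\<^sub>R y j))
    = (\<Sum>i\<in>I. \<Sum>j\<in>J. a i * b j * (y i \<bullet> (A *v y j)))"
proof -
  have lin: "A *v (\<Sum>j\<in>J. b j *\<^sub>R y j) = (\<Sum>j\<in>J. b j *\<^sub>R (A *v y j))"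
    by (simp add: linear_sum[OF matrix_vector_mul_linear] linear_scale[OF matrix_vector_mul_linear])
  show ?thesis
    unfolding lin inner_sum_left by (simp add: inner_sum_right sum_distrib_left mult_ac)
qed

text \<open>
  Diagonalize the Gram matrix \<open>y i \<bullet> W y j\<close> by an orthogonal matrix and transform the family with it. The
  matrix \<open>\<Sum> outer (y i)\<close>, and hence every sum of a quadratic form over the family, is invariant under
  orthogonal transformations of the family.
\<close>

lemma rotate_family_to_diagonalize:
  fixes y :: "'n::finite \<Rightarrow> real^'m" and W :: "real^'m^'m"
  assumes W: "sym_mat W"
  obtains v :: "'n \<Rightarrow> real^'m"
    where "\<And>i j. i \<noteq> j \<Longrightarrow> v i \<bullet> (W *v v j) = 0"
      "\<And>A. (\<Sum>l\<in>UNIV. v l \<bullet> (A *v v l)) = (\<Sum>i\<in>UNIV. y i \<bullet> (A *v y i))"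
proof -
  define G :: "real^'n^'n" where "G = (\<chi> i j. y i \<bullet> (W *v y j))"
  have "sym_mat G"
    using dot_sym_mat[OF W] by (simp add: sym_mat_def G_def transpose_def vec_eq_iff inner_commute)
  then obtain u :: "'n \<Rightarrow> real^'n" and d where u: "\<And>i j. u i \<bullet> u j = (if i = j then 1 else 0)"
    and d: "\<And>i. G *v u i = d i *\<^sub>R u i"
    using sym_mat_spectral by blast
  define v where "v l = (\<Sum>i\<in>UNIV. (u l $ i) *\<^sub>R y i)" for l
  have vWv: "v k \<bullet> (W *v v l) = u k \<bullet> (G *v u l)" for k l
  proof -
    have "u k \<bullet> (G *v u l) = (\<Sum>i\<in>UNIV. u k $ i * (\<Sum>j\<in>UNIV. G $ i $ j * u l $ j))"
      by (simp add: inner_real_vec matrix_vector_mult_def)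
    also have "\<dots> = v k \<bullet> (W *v v l)"
      unfolding v_def bilinear_sum G_def by (simp add: sum_distrib_left mult_ac)
    finally show ?thesis by simp
  qed
  show ?thesis
  proof (rule that[of v])
    show "v i \<bullet> (W *v v j) = 0" if "i \<noteq> j" for i j
      using that by (simp add: vWv d u)
    fix A :: "real^'m^'m"
    have "(\<Sum>l\<in>UNIV. v l \<bullet> (A *v v l))
      = (\<Sum>l\<in>UNIV. \<Sum>i\<in>UNIV. \<Sum>j\<in>UNIV. u l $ i * u l $ j * (y i \<bullet> (A *v y j)))"
      by (simp add: v_def bilinear_sum)
    also have "\<dots> = (\<Sum>i\<in>UNIV. \<Sum>l\<in>UNIV. \<Sum>j\<in>UNIV. u l $ i * u l $ j * (y i \<bullet> (A *v y j)))"
      by (rule sum.swap)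
    also have "\<dots> = (\<Sum>i\<in>UNIV. \<Sum>j\<in>UNIV. \<Sum>l\<in>UNIV. u l $ i * u l $ j * (y i \<bullet> (A *v y j)))"
      by (intro sum.cong refl sum.swap)
    also have "\<dots> = (\<Sum>i\<in>UNIV. \<Sum>j\<in>UNIV. (if i = j then 1 else 0) * (y i \<bullet> (A *v y j)))"
      by (simp only: orthonormal_family_complete[OF u] flip: sum_distrib_right)
    also have "\<dots> = (\<Sum>i\<in>UNIV. y i \<bullet> (A *v y i))"
      by (simp add: if_distrib[where f = "\<lambda>x. x * _"] cong: if_cong)
    finally show "(\<Sum>l\<in>UNIV. v l \<bullet> (A *v v l)) = (\<Sum>i\<in>UNIV. y i \<bullet> (A *v y i))" .
  qed
qed

definition signed_combination :: "('i::finite \<Rightarrow> 'a::real_vector) \<Rightarrow> 'i set \<Rightarrow> 'a" where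
  "signed_combination v B = (\<Sum>i\<in>UNIV. (if i \<in> B then 1 else - 1) *\<^sub>R v i)"

lemma inner_signed_combination:
  "e \<bullet> signed_combination v B = signed_sum UNIV (\<lambda>i. e \<bullet> v i) B"
  by (simp add: signed_combination_def signed_sum_def inner_sum_right)

text \<open>
  Without cross terms every product of signs that survives is a square, so that the form does not depend
  on the signs.
\<close>

lemma signed_combination_quadratic_form:
  fixes v :: "'i::finite \<Rightarrow> real^'n" and W :: "real^'n^'n"
  assumes "\<And>i j. i \<noteq> j \<Longrightarrow> v i \<bullet> (W *v v j) = 0"
  shows "signed_combination v B \<bullet> (W *v signed_combination v B) = (\<Sum>i\<in>UNIV. v i \<bullet> (W *v v i))"
proof -
  let ?e = "\<lambda>i. if i \<in> B then 1 else (- 1 :: real)"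
  have "?e i * ?e j * (v i \<bullet> (W *v v j)) = (if j = i then v i \<bullet> (W *v v i) else 0)" for i j
    using assms[of i j] by auto
  then show ?thesis
    unfolding signed_combination_def bilinear_sum by simp
qed

text \<open>
  A semidefinite form is a sum of squares of linear forms, and a linear form of a signed combination is
  a Rademacher sum.
\<close>

lemma psd_signed_combination_tail:
  fixes S :: "real^'n^'n" and v :: "'i::finite \<Rightarrow> real^'n"
  assumes S: "psd S" and bound: "(\<Sum>i\<in>UNIV. v i \<bullet> (S *v v i)) \<le> c" and "0 < c" "0 \<le> g"
  shows "sign_mean UNIV (\<lambda>B. of_bool (signed_combination v B \<bullet> (S *v signed_combination v B) > g * c))
    \<le> sqrt 3 * exp (- (g / 3))"
proof -
  obtain w :: "'n \<Rightarrow> real^'n" where w: "S = (\<Sum>l\<in>UNIV. outer (w l))" by (rule psd_eq_sum_outer[OF S])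
  have form: "y \<bullet> (S *v y) = (\<Sum>l\<in>UNIV. (w l \<bullet> y)\<^sup>2)" for y
  proof -
    have "y \<bullet> (S *v y) = S \<bullet> outer y" by (simp only: inner_outer)
    also have "\<dots> = (\<Sum>l\<in>UNIV. (w l \<bullet> y)\<^sup>2)"
      unfolding w inner_sum_left inner_outer_outer ..
    finally show ?thesis .
  qed
  have "(\<Sum>l\<in>UNIV. \<Sum>i\<in>UNIV. (w l \<bullet> v i)\<^sup>2) \<le> c"
    using bound unfolding form by (subst sum.swap)
  from sign_mean_sum_squares_tail[OF _ _ this assms(3,4)]
  show ?thesis by (simp add: form inner_signed_combination)
qed

text \<open>
  Split \<open>V\<close> as \<open>\<Sum> outer (v i)\<close> with a family without cross terms for \<open>W\<close>. Every choice of signs then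
  reproduces the value \<open>W \<bullet> V\<close> exactly. The linear condition holds with probability at least \<open>1 / 3\<close>, and each
  of the \<open>K\<close> semidefinite conditions fails with probability at most \<open>sqrt 3 * exp (- ln (6 * K)) = sqrt 3 / (6 * K)\<close>.
  Since \<open>sqrt 3 / 6 < 1 / 3\<close>, some choice of signs meets all of them.
\<close>

theorem sign_rounding:
  fixes V W :: "real^'n^'n" and S :: "'k::finite \<Rightarrow> real^'n^'n" and c :: "'k \<Rightarrow> real" and e :: "real^'n"
  assumes V: "psd V" and W: "sym_mat W" and S: "\<And>k. psd (S k)"
    and e: "outer e \<bullet> V \<le> 1" and c: "\<And>k. 0 < c k" "\<And>k. S k \<bullet> V \<le> c k"
  obtains y where "y \<bullet> (W *v y) = W \<bullet> V" "\<bar>e \<bullet> y\<bar> \<le> 1"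
    "\<And>k. y \<bullet> (S k *v y) \<le> 3 * ln (6 * real CARD('k)) * c k"
proof -
  obtain y :: "'n \<Rightarrow> real^'n" where y: "V = (\<Sum>l\<in>UNIV. outer (y l))" by (rule psd_eq_sum_outer[OF V])
  obtain v :: "'n \<Rightarrow> real^'n" where cross: "\<And>i j. i \<noteq> j \<Longrightarrow> v i \<bullet> (W *v v j) = 0"
    and v: "\<And>A. (\<Sum>l\<in>UNIV. v l \<bullet> (A *v v l)) = (\<Sum>i\<in>UNIV. y i \<bullet> (A *v y i))"
    by (rule rotate_family_to_diagonalize[OF W, where y = y]) (rule that)
  have trace: "(\<Sum>l\<in>UNIV. v l \<bullet> (A *v v l)) = A \<bullet> V" for A
    unfolding v by (simp add: y inner_sum_right inner_outer)
  let ?Y = "signed_combination v"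
  define K where "K = real CARD('k)"
  have K: "1 \<le> K" by (simp add: K_def Suc_le_eq)
  define g where "g = 3 * ln (6 * K)"
  have g: "0 \<le> g" "exp (- (g / 3)) = 1 / (6 * K)"
    using K by (auto simp: g_def exp_minus field_simps)
  let ?bad = "\<lambda>k B. ?Y B \<bullet> (S k *v ?Y B) > g * c k"
  have "sign_mean UNIV (\<lambda>B. \<Sum>k\<in>UNIV. of_bool (?bad k B)) \<le> (\<Sum>k\<in>(UNIV::'k set). sqrt 3 * (1 / (6 * K)))"
    unfolding sign_mean_sum g(2)[symmetric]
    by (intro sum_mono psd_signed_combination_tail S c g) (simp add: trace c)
  also have "\<dots> = sqrt 3 / 6" using K by (simp add: K_def)
  also have "\<dots> < 1 / 3" by (simp add: real_less_lsqrt)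
  also have "1 / 3 \<le> sign_mean UNIV (\<lambda>B. of_bool (\<bar>e \<bullet> ?Y B\<bar> \<le> 1))"
  proof -
    have "(\<Sum>i\<in>UNIV. (e \<bullet> v i)\<^sup>2) = (\<Sum>i\<in>UNIV. v i \<bullet> (outer e *v v i))"
      by (simp only: inner_outer_outer flip: inner_outer)
    then have "(\<Sum>i\<in>UNIV. (e \<bullet> v i)\<^sup>2) \<le> 1" using e by (simp add: trace)
    then show ?thesis unfolding inner_signed_combination by (intro sign_mean_small_ball) auto
  qed
  finally have less: "sign_mean UNIV (\<lambda>B. \<Sum>k\<in>UNIV. of_bool (?bad k B))
    < sign_mean UNIV (\<lambda>B. of_bool (\<bar>e \<bullet> ?Y B\<bar> \<le> 1))" .
  obtain B where B: "(\<Sum>k\<in>UNIV. of_bool (?bad k B)) < (of_bool (\<bar>e \<bullet> ?Y B\<bar> \<le> 1) :: real)"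
    using less by (rule sign_mean_less_obtains)
  have nonneg: "(0::real) \<le> (\<Sum>k\<in>UNIV. of_bool (?bad k B))" by (simp add: sum_nonneg)
  with B have small: "\<bar>e \<bullet> ?Y B\<bar> \<le> 1" by (cases "\<bar>e \<bullet> ?Y B\<bar> \<le> 1") auto
  have good: "\<not> ?bad k B" for k
  proof
    assume "?bad k B"
    then have "1 \<le> (\<Sum>k\<in>UNIV. of_bool (?bad k B) :: real)"
      by (intro order_trans[OF _ member_le_sum[of k]]) auto
    with B small show False by simp
  qed
  show ?thesis
  proof (rule that[of "?Y B"])
    show "?Y B \<bullet> (W *v ?Y B) = W \<bullet> V"
      by (simp add: signed_combination_quadratic_form[OF cross] trace)
    show "?Y B \<bullet> (S k *v ?Y B) \<le> 3 * ln (6 * real CARD('k)) * c k" for k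
      using good[of k] by (simp add: g_def K_def not_less)
  qed (rule small)
qed

section \<open>Quadratic forms of bordered matrices\<close>

lemma sum_option:
  fixes f :: "'m::finite option \<Rightarrow> 'a::comm_monoid_add"
  shows "(\<Sum>i\<in>UNIV. f i) = f None + (\<Sum>j\<in>UNIV. f (Some j))"
  by (simp add: UNIV_option_conv sum.reindex)

definition vec_some :: "real^('m option) \<Rightarrow> real^'m" where
  "vec_some y = (\<chi> j. y $ Some j)"

lemma bordered_quadratic_form:
  fixes y :: "real^('m::finite option)"
  shows "y \<bullet> (bordered A b c d *v y) = vec_some y \<bullet> (A *v vec_some y)
    + y $ None * (b \<bullet> vec_some y) + y $ None * (c \<bullet> vec_some y) + d * (y $ None)\<^sup>2"
  by (simp add: inner_real_vec matrix_vector_mult_def sum_option bordered_def vec_some_def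
      sum.distrib sum_distrib_left distrib_left power2_eq_square mult_ac)

lemma sym_mat_bordered:
  assumes "sym_mat A"
  shows "sym_mat (bordered A b b d)"
proof -
  have "A $ j $ i = A $ i $ j" for i j
    using assms by (auto simp: sym_mat_def transpose_def vec_eq_iff)
  then show ?thesis
    by (auto simp: sym_mat_def transpose_def bordered_def vec_eq_iff split: option.splits)
qed

lemma matrix_vector_mult_sum_left: "(\<Sum>k\<in>K. A k) *v z = (\<Sum>k\<in>K. A k *v z)"
  for A :: "'k \<Rightarrow> real^'n^'m"
  by (induction K rule: infinite_finite_induct) (auto simp: matrix_vector_mult_add_rdistrib)

lemma congruence_quadratic_form:
  fixes P :: "real^'m^'n"
  shows "z \<bullet> ((transpose P ** X ** P) *v z) = (P *v z) \<bullet> (X *v (P *v z))"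
  by (metis dot_lmul_matrix inner_commute matrix_vector_mul_assoc transpose_matrix_vector)

lemma sym_mat_congruence:
  assumes "sym_mat X"
  shows "sym_mat (transpose P ** X ** P)"
  using assms by (simp add: sym_mat_def matrix_transpose_mul matrix_mul_assoc)

section \<open>The safe approximation and its tightness\<close>

text \<open>
  Evaluate the semidefinite constraint at \<open>(z, 1)\<close>: the form \<open>\<zeta> \<bullet> X \<zeta> + 2 * (x \<bullet> \<zeta>)\<close> at \<open>\<zeta> = P z\<close> is bounded by
  \<open>\<Sum> l\<^sub>k * (z \<bullet> S\<^sub>k z) + \<tau>\<close>.
\<close>

lemma S_feasible_imp_C_feasible:
  fixes P :: "real^'m^'n" and T :: "(real^'k::finite) set"
  assumes "compact T" "0 \<le> \<rho>" and feas: "S_feasible P S T \<rho> X x \<xi> l \<tau>"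
  shows "C_feasible P S T \<rho> X x \<xi>"
  unfolding C_feasible_def
proof
  fix \<zeta> assume "\<zeta> \<in> ellitope P S T \<rho>"
  then obtain z t where z: "t \<in> T" "\<zeta> = P *v z" "\<And>k. z \<bullet> (S k *v z) \<le> \<rho> * t $ k"
    by (auto simp: ellitope_def)
  define y :: "real^('m option)" where "y = (\<chi> i. case i of None \<Rightarrow> 1 | Some j \<Rightarrow> z $ j)"
  have y: "vec_some y = z" "y $ None = 1" by (simp_all add: y_def vec_some_def)
  let ?B = "bordered ((\<Sum>k\<in>UNIV. l $ k *\<^sub>R S k) - transpose P ** X ** P)
    (- (transpose P *v x)) (- (x v* P)) \<tau>"
  have l: "\<And>k. 0 \<le> l $ k" and obj: "\<rho> * support_fun T l + \<tau> \<le> \<xi>" and "psd ?B"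
    using feas by (auto simp: S_feasible_def)
  then have "0 \<le> y \<bullet> (?B *v y)" by (simp add: psd_def)
  then have "\<zeta> \<bullet> (X *v \<zeta>) + 2 * (x \<bullet> \<zeta>) \<le> (\<Sum>k\<in>UNIV. l $ k * (z \<bullet> (S k *v z))) + \<tau>"
    by (simp add: bordered_quadratic_form y matrix_vector_mult_diff_rdistrib inner_diff_right
        congruence_quadratic_form matrix_vector_mult_sum_left inner_sum_right scaleR_matrix_vector_assoc[symmetric]
        dot_lmul_matrix z(2))
  also have "\<dots> \<le> (\<Sum>k\<in>UNIV. l $ k * (\<rho> * t $ k)) + \<tau>"
    by (intro add_right_mono sum_mono mult_left_mono z l)
  also have "\<dots> = \<rho> * (l \<bullet> t) + \<tau>"
    by (simp add: inner_real_vec sum_distrib_left mult_ac)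
  also have "\<dots> \<le> \<rho> * support_fun T l + \<tau>"
  proof -
    have "T \<noteq> {}" using z(1) by blast
    from support_fun_max[OF assms(1) this, of l] have "l \<bullet> t \<le> support_fun T l" using z(1) by auto
    then show ?thesis using assms(2) by (simp add: mult_left_mono)
  qed
  finally show "\<zeta> \<bullet> (X *v \<zeta>) + 2 * (x \<bullet> \<zeta>) \<le> \<xi>" using obj by linarith
qed

text \<open>
  Homogenize by a coordinate \<open>None\<close> with the constraint that its square is at most \<open>1\<close>; its multiplier is \<open>\<tau>\<close>.
  An infeasible system leaves the primal side of the alternative, a second-moment matrix \<open>V\<close>, and sign rounding
  replaces \<open>V\<close> by a vector \<open>(z, y\<^sub>0)\<close> with \<open>\<bar>y\<^sub>0\<bar> \<le> 1\<close>. The linear term \<open>2 * y\<^sub>0 * (x \<bullet> P z)\<close> only grows when \<open>y\<^sub>0\<close> is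
  replaced by the sign of \<open>x \<bullet> P z\<close>, so \<open>P z\<close> or \<open>- P z\<close> violates the constraint.
\<close>

lemma not_S_feasible_imp_not_C_feasible:
  fixes P :: "real^'m^'n" and S :: "'k::finite \<Rightarrow> real^'m^'m" and T :: "(real^'k) set"
  assumes S: "\<And>k. psd (S k)" and T: "convex T" "compact T"
    and t0: "t0 \<in> T" "\<And>k. 0 < t0 $ k"
    and \<rho>: "0 < \<rho>" and X: "sym_mat X"
    and infeas: "\<nexists>l \<tau>. S_feasible P S T \<rho> X x \<xi> l \<tau>"
  shows "\<not> C_feasible P S T (3 * ln (6 * real CARD('k)) * \<rho>) X x \<xi>"
proof -
  let ?g = "3 * ln (6 * real CARD('k))"
  define e :: "real^('m option)" where "e = axis None 1"
  define W where "W = bordered (transpose P ** X ** P) (transpose P *v x) (transpose P *v x) 0"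
  define S' where "S' k = bordered (S k) 0 0 0" for k
  define A where "A i = (case i of None \<Rightarrow> outer e | Some k \<Rightarrow> S' k)" for i
  define R :: "(real^('k option)) set" where "R = {r. r $ None = 1 \<and> (1 / \<rho>) *\<^sub>R vec_some r \<in> T}"
  define lift where "lift t = (\<chi> i. case i of None \<Rightarrow> 1 | Some k \<Rightarrow> \<rho> * t $ k)" for t :: "real^'k"
  have e: "e \<bullet> y = y $ None" for y by (simp add: e_def inner_commute inner_axis)
  have lift: "lift t \<in> R" if "t \<in> T" for t
  proof -
    have "(1 / \<rho>) *\<^sub>R vec_some (lift t) = t" using \<rho> by (simp add: vec_eq_iff vec_some_def lift_def)
    with that show ?thesis by (simp add: R_def lift_def)
  qed
  have W: "y \<bullet> (W *v y) = (P *v vec_some y) \<bullet> (X *v (P *v vec_some y)) + 2 * y $ None * (x \<bullet> (P *v vec_some y))" for y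
    by (simp add: W_def bordered_quadratic_form congruence_quadratic_form dot_lmul_matrix)
  have S': "y \<bullet> (S' k *v y) = vec_some y \<bullet> (S k *v vec_some y)" for y k
    by (simp add: S'_def bordered_quadratic_form)
  have psd_S': "psd (S' k)" for k
    using S[of k] S' by (simp add: psd_def) (simp add: S'_def sym_mat_bordered)
  have outer_e: "y \<bullet> (outer e *v y) = (y $ None)\<^sup>2" for y
    by (simp add: e inner_outer_outer flip: inner_outer)
  have convex_R: "convex R"
  proof (rule convexI)
    fix r s :: "real^('k option)" and a b :: real
    assume rs: "r \<in> R" "s \<in> R" and ab: "0 \<le> a" "0 \<le> b" "a + b = 1"
    have "(1 / \<rho>) *\<^sub>R vec_some (a *\<^sub>R r + b *\<^sub>R s)
      = a *\<^sub>R ((1 / \<rho>) *\<^sub>R vec_some r) + b *\<^sub>R ((1 / \<rho>) *\<^sub>R vec_some s)"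
      by (simp add: vec_eq_iff vec_some_def add_divide_distrib)
    also have "\<dots> \<in> T" using rs ab T(1) by (intro convexD) (auto simp: R_def)
    finally show "a *\<^sub>R r + b *\<^sub>R s \<in> R" using rs ab by (simp add: R_def)
  qed
  have lift_pos: "0 < lift t0 $ i" for i using t0 \<rho> by (cases i) (auto simp: lift_def)
  show ?thesis
  proof (cases rule: semidefinite_alternative[OF convex_R lift[OF t0(1)] lift_pos,
        where W = W and A = A and \<xi> = \<xi>, case_names dual primal])
    case (dual \<mu>)
    define l where "l = vec_some \<mu>"
    define \<tau> where "\<tau> = \<mu> $ None"
    have l: "\<mu> $ Some k = l $ k" for k by (simp add: l_def vec_some_def)
    let ?M = "(\<Sum>k\<in>UNIV. l $ k *\<^sub>R S k) - transpose P ** X ** P"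
    have M: "z \<bullet> (?M *v z) = (\<Sum>k\<in>UNIV. l $ k * (z \<bullet> (S k *v z))) - (P *v z) \<bullet> (X *v (P *v z))" for z
      by (simp add: matrix_vector_mult_diff_rdistrib inner_diff_right congruence_quadratic_form
          matrix_vector_mult_sum_left inner_sum_right scaleR_matrix_vector_assoc[symmetric])
    have "sym_mat ?M"
    proof -
      have "transpose (\<Sum>k\<in>UNIV. l $ k *\<^sub>R S k) = (\<Sum>k\<in>UNIV. l $ k *\<^sub>R S k)"
      proof -
        have "S k $ j $ i = S k $ i $ j" for i j k
          using S[of k] by (auto simp: psd_def sym_mat_def transpose_def vec_eq_iff)
        then show ?thesis by (simp add: transpose_def vec_eq_iff)
      qed
      moreover have "transpose (transpose P ** X ** P) = transpose P ** X ** P"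
        using sym_mat_congruence[OF X] by (simp add: sym_mat_def)
      ultimately show ?thesis by (simp add: sym_mat_def transpose_def vec_eq_iff)
    qed
    moreover have "0 \<le> y \<bullet> (bordered ?M (- (transpose P *v x)) (- (x v* P)) \<tau> *v y)" for y
      using dual(2)[of y]
      by (simp add: bordered_quadratic_form M W sum_option A_def S' outer_e l \<tau>_def dot_lmul_matrix)
    ultimately have "psd (bordered ?M (- (transpose P *v x)) (- (x v* P)) \<tau>)"
      by (simp add: psd_def sym_mat_bordered)
    moreover have "\<rho> * support_fun T l + \<tau> \<le> \<xi>"
    proof -
      obtain t where t: "t \<in> T" "support_fun T l = l \<bullet> t"
        using support_fun_max[OF T(2), of l] t0(1) by blast
      have "\<mu> \<bullet> lift t = \<rho> * (l \<bullet> t) + \<tau>"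
        by (simp add: inner_real_vec sum_option lift_def l_def \<tau>_def vec_some_def sum_distrib_left mult_ac)
      with dual(3)[OF lift[OF t(1)]] t(2) show ?thesis by simp
    qed
    ultimately have "S_feasible P S T \<rho> X x \<xi> l \<tau>"
      using dual(1) by (simp add: S_feasible_def l_def vec_some_def)
    with infeas show ?thesis by blast
  next
    case (primal V r)
    define t where "t = (1 / \<rho>) *\<^sub>R vec_some r"
    have t: "t \<in> T" "\<And>k. r $ Some k = \<rho> * t $ k"
      using primal(2) \<rho> by (auto simp: R_def t_def vec_some_def)
    have SV: "S' k \<bullet> V < \<rho> * t $ k" for k
      using primal(3)[of "Some k"] by (simp add: A_def t)
    \<comment> \<open>The strict inequality in the certificate excludes vanishing bounds.\<close>
    have pos: "0 < \<rho> * t $ k" for k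
      using psd_inner_nonneg[OF psd_S' primal(1), of k] SV[of k] by linarith
    have eV: "outer e \<bullet> V \<le> 1"
      using primal(2) primal(3)[of None] by (simp add: A_def R_def)
    have "sym_mat W" unfolding W_def by (intro sym_mat_bordered sym_mat_congruence X)
    then obtain y :: "real^('m option)" where y: "y \<bullet> (W *v y) = W \<bullet> V" "\<bar>e \<bullet> y\<bar> \<le> 1"
        "\<And>k. y \<bullet> (S' k *v y) \<le> ?g * (\<rho> * t $ k)"
      by (rule sign_rounding[where S = S' and c = "\<lambda>k. \<rho> * t $ k",
            OF primal(1) _ psd_S' eV pos less_imp_le[OF SV]]) (rule that)
    define z where "z = vec_some y"
    define s :: real where "s = (if 0 \<le> x \<bullet> (P *v z) then 1 else - 1)"
    define \<zeta> where "\<zeta> = P *v (s *\<^sub>R z)"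
    have \<zeta>: "\<zeta> = s *\<^sub>R (P *v z)" by (simp add: \<zeta>_def linear_scale[OF matrix_vector_mul_linear])
    have ss: "s * s = 1" by (simp add: s_def)
    have "(s *\<^sub>R z) \<bullet> (S k *v (s *\<^sub>R z)) = (s * s) * (z \<bullet> (S k *v z))" for k
      by (simp add: linear_scale[OF matrix_vector_mul_linear])
    then have "(s *\<^sub>R z) \<bullet> (S k *v (s *\<^sub>R z)) \<le> ?g * \<rho> * t $ k" for k
      using y(3)[of k] by (simp add: ss S' z_def mult.assoc)
    then have "\<zeta> \<in> ellitope P S T (?g * \<rho>)"
      unfolding ellitope_def \<zeta>_def using t(1) by blast
    moreover have "\<xi> < \<zeta> \<bullet> (X *v \<zeta>) + 2 * (x \<bullet> \<zeta>)"
    proof -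
      have "\<xi> < (P *v z) \<bullet> (X *v (P *v z)) + 2 * (y $ None * (x \<bullet> (P *v z)))"
        using primal(4) y(1) W[of y] by (simp add: z_def)
      moreover have "\<zeta> \<bullet> (X *v \<zeta>) = (s * s) * ((P *v z) \<bullet> (X *v (P *v z)))"
        by (simp add: \<zeta> linear_scale[OF matrix_vector_mul_linear])
      moreover have "y $ None * (x \<bullet> (P *v z)) \<le> x \<bullet> \<zeta>"
      proof -
        \<comment> \<open>\<open>s\<close> is the sign of \<open>x \<bullet> P z\<close>, so \<open>x \<bullet> \<zeta>\<close> is its absolute value.\<close>
        have "y $ None * (x \<bullet> (P *v z)) \<le> \<bar>y $ None\<bar> * \<bar>x \<bullet> (P *v z)\<bar>"
          by (simp flip: abs_mult)
        also have "\<dots> \<le> 1 * \<bar>x \<bullet> (P *v z)\<bar>"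
          using y(2) by (intro mult_right_mono) (auto simp: e)
        also have "\<dots> = x \<bullet> \<zeta>" by (simp add: \<zeta> s_def)
        finally show ?thesis .
      qed
      ultimately show ?thesis by (simp add: ss)
    qed
    ultimately show ?thesis by (auto simp: C_feasible_def not_le)
  qed
qed

theorem theorem2:
  fixes P :: "real^'m^'n"
    and S :: "'k::finite \<Rightarrow> real^'m^'m"
    and T :: "(real^'k) set"
    and \<rho> :: real
  assumes S_psd: "\<And>k. psd (S k)"
    and S_sum: "posdef (\<Sum>k\<in>UNIV. S k)"
    and T_nonneg: "T \<subseteq> {t. \<forall>k. 0 \<le> t $ k}"
    and T_nonempty: "T \<noteq> {}"
    and T_convex: "convex T"
    and T_compact: "compact T"
    and T_interior: "T \<inter> interior {t. \<forall>k. 0 \<le> t $ k} \<noteq> {}"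
    and T_monotone: "\<And>t t'. (\<forall>k. 0 \<le> t $ k \<and> t $ k \<le> t' $ k) \<Longrightarrow> t' \<in> T \<Longrightarrow> t \<in> T"
    and \<rho>_pos: "\<rho> > 0"
  shows "(\<forall>X x \<xi>. sym_mat X \<longrightarrow>
            (\<exists>l \<tau>. S_feasible P S T \<rho> X x \<xi> l \<tau>) \<longrightarrow> C_feasible P S T \<rho> X x \<xi>)
       \<and> (\<forall>X x \<xi>. sym_mat X \<longrightarrow>
            \<not> (\<exists>l \<tau>. S_feasible P S T \<rho> X x \<xi> l \<tau>) \<longrightarrow>
            \<not> C_feasible P S T (3 * ln (6 * real CARD('k)) * \<rho>) X x \<xi>)"
proof -
  obtain t0 where t0: "t0 \<in> T" "t0 \<in> interior {t. \<forall>k. 0 \<le> t $ k}" using T_interior by blast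
  have pos: "0 < t0 $ k" for k
  proof -
    have "interior {t :: real^'k. \<forall>k. 0 \<le> t $ k} \<subseteq> interior {t. 0 \<le> t $ k}"
      by (intro interior_mono) auto
    then show ?thesis using t0(2) by auto
  qed
  show ?thesis
    using S_feasible_imp_C_feasible[OF T_compact less_imp_le[OF \<rho>_pos]]
      not_S_feasible_imp_not_C_feasible[where S = S, OF S_psd T_convex T_compact t0(1) pos \<rho>_pos]
    by blast
qed

end
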